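(* Let $\alpha\in\mathbb{R}$, $q_0\in L^2(0,\pi)$ and let $k\ge1$ be an integer. Then: (i) for any $\lambda\ge\lambda_k(q_0)$, problem $(NP_\delta)$ with $\delta=1$ has no non-zero weak solution with $k-1$ or fewer roots in $(0,\pi)$; (ii) for any $\lambda\le\lambda_k(q_0)$, problem $(NP_\delta)$ with $\delta=-1$ has no non-zero weak solution with $k-1$ or more roots in $(0,\pi)$.
   Context: $L^2(0,\pi)$ is the space of real-valued square-integrable functions. Fix $\alpha\in\mathbb{R}$. For $q\in L^2(0,\pi)$, $\mathcal{L}[q]$ denotes the self-adjoint Sturm–Liouville operator on $L^2(0,\pi)$ given by $\mathcal{L}[q]u=-u''+q(x)u$ subject to the separated boundary conditions $$u(0)\cos\alpha+u'(0)\sin\alpha=0,\qquad u(\pi)\cos\alpha+u'(\pi)\sin\alpha=0.$$ Its spectrum is a sequence of simple eigenvalues $\lambda_1(q)<\lambda_2(q)<\cdots$. For $\lambda\in\mathbb{R}$ and $\delta\in\{1,-1\}$, $(NP_\delta)$ denotes the nonlinear boundary value problem $$-u''+q_0(x)u=\lambda u+\delta u^3,\quad x\in(0,\pi),$$ $$u(0)\cos\alpha+u'(0)\sin\alpha=0,\qquad u(\pi)\cos\alpha+u'(\pi)\sin\alpha=0.$$ Weak solutions are understood in the standard sense (equivalently, $u\in W^{2,2}(0,\pi)$ satisfying the equation a.e. and the boundary conditions). *)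

theory Defs
  imports "HOL-Analysis.Analysis"
begin

definition L2_0pi :: "(real \<Rightarrow> real) set" where
  "L2_0pi = {f. f \<in> borel_measurable (lebesgue_on {0<..<pi}) \<and>
                integrable (lebesgue_on {0<..<pi}) (\<lambda>x. (f x)\<^sup>2)}"

text \<open>
  In one dimension W^{2,2}(0,pi) consists of the C^1 functions on [0,pi] whose derivative is
  absolutely continuous with a square-integrable derivative. Here u is this C^1 representative
  (only its values on [0,pi] matter), v is its derivative up to the end points, and w is the
  second derivative: the last clause says that v is absolutely continuous with v' = w almost
  everywhere.
\<close>

definition W22_0pi :: "(real \<Rightarrow> real) \<Rightarrow> (real \<Rightarrow> real) \<Rightarrow> (real \<Rightarrow> real) \<Rightarrow> bool" where
  "W22_0pi u v w \<longleftrightarrow>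
     (\<forall>x\<in>{0..pi}. (u has_real_derivative v x) (at x within {0..pi})) \<and>
     w \<in> L2_0pi \<and>
     (\<forall>x\<in>{0..pi}. v x = v 0 + (LINT t:{0<..<x}|lebesgue. w t))"

definition separated_bc :: "real \<Rightarrow> (real \<Rightarrow> real) \<Rightarrow> (real \<Rightarrow> real) \<Rightarrow> bool" where
  "separated_bc \<alpha> u v \<longleftrightarrow>
     u 0 * cos \<alpha> + v 0 * sin \<alpha> = 0 \<and> u pi * cos \<alpha> + v pi * sin \<alpha> = 0"

text \<open>
  The graph of the operator L[q]: u belongs to the domain and -u'' + q u = f almost everywhere.
  For q in L^2(0,pi) the self-adjoint domain is all of W^{2,2}(0,pi) subject to the boundary
  conditions, because q u is square-integrable for every bounded u.
\<close>

definition SL_operator ::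
  "real \<Rightarrow> (real \<Rightarrow> real) \<Rightarrow> (real \<Rightarrow> real) \<Rightarrow> (real \<Rightarrow> real) \<Rightarrow> bool" where
  "SL_operator \<alpha> q u f \<longleftrightarrow>
     (\<exists>v w. W22_0pi u v w \<and> separated_bc \<alpha> u v \<and>
            (AE x in lebesgue_on {0<..<pi}. - w x + q x * u x = f x))"

definition nonzero_0pi :: "(real \<Rightarrow> real) \<Rightarrow> bool" where
  "nonzero_0pi u \<longleftrightarrow> (\<exists>x\<in>{0..pi}. u x \<noteq> 0)"

definition SL_eigenvalue :: "real \<Rightarrow> (real \<Rightarrow> real) \<Rightarrow> real \<Rightarrow> bool" where
  "SL_eigenvalue \<alpha> q l \<longleftrightarrow> (\<exists>u. nonzero_0pi u \<and> SL_operator \<alpha> q u (\<lambda>x. l * u x))"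

text \<open>
  The k-th eigenvalue in increasing order, counted from k = 1. The eigenvalues are simple, so
  counting them as a set agrees with counting multiplicities.
\<close>

definition SL_lambda :: "real \<Rightarrow> nat \<Rightarrow> (real \<Rightarrow> real) \<Rightarrow> real" where
  "SL_lambda \<alpha> k q = (THE l. SL_eigenvalue \<alpha> q l \<and>
     finite {m. SL_eigenvalue \<alpha> q m \<and> m < l} \<and>
     Suc (card {m. SL_eigenvalue \<alpha> q m \<and> m < l}) = k)"

text \<open>
  Weak solutions in their equivalent strong form. Since u is bounded, q0 u and the cubic term are
  square-integrable, so every weak solution lies in W^{2,2}(0,pi).
\<close>

definition NP_weak_solution ::
  "real \<Rightarrow> (real \<Rightarrow> real) \<Rightarrow> real \<Rightarrow> real \<Rightarrow> (real \<Rightarrow> real) \<Rightarrow> bool" where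
  "NP_weak_solution \<alpha> q0 l d u \<longleftrightarrow> SL_operator \<alpha> q0 u (\<lambda>x. l * u x + d * u x ^ 3)"

definition roots_0pi :: "(real \<Rightarrow> real) \<Rightarrow> real set" where
  "roots_0pi u = {x \<in> {0<..<pi}. u x = 0}"

end

theory Submission
  imports Defs
begin

text \<open>
  A solution \<open>u\<close> of the nonlinear problem solves the linear equation \<open>-u'' + q0 u = h u\<close> with
  \<open>h = l + \<delta> u\<^sup>2\<close> and the same boundary conditions. Compare it with an eigenfunction \<open>\<phi>\<close> of \<open>L[q0]\<close> for
  \<open>\<lambda>\<^sub>k\<close>, which has \<open>k - 1\<close> roots in \<open>(0, pi)\<close>. If \<open>\<delta> = 1\<close> and \<open>l \<ge> \<lambda>\<^sub>k\<close>, then \<open>h > \<lambda>\<^sub>k\<close> wherever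
  \<open>u \<noteq> 0\<close>, and Sturm's comparison theorem gives \<open>u\<close> strictly more roots than \<open>\<phi>\<close>. If \<open>\<delta> = -1\<close> and
  \<open>l \<le> \<lambda>\<^sub>k\<close>, the inequality is reversed, and \<open>u\<close> has strictly fewer roots than \<open>\<phi>\<close>; its roots are
  finite in number because a nontrivial solution has no double root.

  The comparison (\<open>SL_comparison\<close>) is a Wronskian argument: every nodal interval of the solution with
  the smaller coefficient contains a root of the other one, including the first and the last
  interval, where the common boundary condition replaces a root.

  The larger part of the proof is Sturm's oscillation theorem, that the \<open>k\<close>-th eigenvalue exists and
  has an eigenfunction with \<open>k - 1\<close> roots (\<open>SL_lambda_eigenfunction\<close>). By the comparison,
  the number of roots is strictly increasing in the eigenvalue, and it depends on the eigenvalue only.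
  It remains to find, for every \<open>n\<close>, an eigenfunction with \<open>n\<close> roots (\<open>eigenfunction_with_roots\<close>). This
  is done by shooting with a scaled Pruefer phase, which crosses the multiples of \<open>pi\<close> upwards only.

  A potential that is merely square-integrable is removed at the start: with a primitive \<open>Q\<close> of \<open>q0\<close>
  and \<open>z = u' - Q u\<close>, the equation becomes the system \<open>u' = z + Q u\<close>, \<open>z' = - (h + Q\<^sup>2) u - Q z\<close>
  with continuous coefficients. The Wronskian and the boundary conditions carry over, so all
  later arguments are classical calculus.
\<close>

section \<open>The quasi-derivative system\<close>

text \<open>
  First-order form of \<open>-u'' + q u = h u\<close> on \<open>[0, pi]\<close>, where \<open>Q\<close> is a primitive of \<open>q\<close> and
  \<open>z = u' - Q u\<close> is the quasi-derivative of \<open>u\<close>. Differentiating \<open>z\<close> cancels the term \<open>q u\<close>, so that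
  only the continuous function \<open>Q\<close> remains and both equations hold everywhere, in the
  classical sense. The coefficient \<open>h\<close> is a function because \<open>h = l + \<delta> u\<^sup>2\<close> covers the nonlinear
  equation; a linear eigenvalue equation has constant \<open>h\<close>.
\<close>

definition quasi_sol ::
  "(real \<Rightarrow> real) \<Rightarrow> (real \<Rightarrow> real) \<Rightarrow> (real \<Rightarrow> real) \<Rightarrow> (real \<Rightarrow> real) \<Rightarrow> bool" where
  "quasi_sol Q h u z \<longleftrightarrow>
     (\<forall>x\<in>{0..pi}. (u has_real_derivative z x + Q x * u x) (at x within {0..pi}) \<and>
        (z has_real_derivative - (h x + (Q x)\<^sup>2) * u x - Q x * z x) (at x within {0..pi}))"

lemma quasi_solD:
  assumes "quasi_sol Q h u z" "x \<in> {0..pi}"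
  shows "(u has_real_derivative z x + Q x * u x) (at x within {0..pi})"
    and "(z has_real_derivative - (h x + (Q x)\<^sup>2) * u x - Q x * z x) (at x within {0..pi})"
  using assms unfolding quasi_sol_def by blast+

lemma quasi_sol_continuous:
  assumes "quasi_sol Q h u z"
  shows "continuous_on {0..pi} u" "continuous_on {0..pi} z"
  by (rule DERIV_continuous_on, rule quasi_solD[OF assms], assumption)+

lemma quasi_sol_uminus:
  assumes "quasi_sol Q h u z"
  shows "quasi_sol Q h (\<lambda>x. - u x) (\<lambda>x. - z x)"
  unfolding quasi_sol_def
proof (intro ballI conjI)
  fix x assume x: "x \<in> {0..pi}"
  show "((\<lambda>x. - u x) has_real_derivative - z x + Q x * - u x) (at x within {0..pi})"
    using DERIV_minus[OF quasi_solD(1)[OF assms x]] by simp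
  show "((\<lambda>x. - z x) has_real_derivative - (h x + (Q x)\<^sup>2) * - u x - Q x * - z x)
          (at x within {0..pi})"
    using DERIV_minus[OF quasi_solD(2)[OF assms x]] by simp
qed

text \<open>
  The Wronskian \<open>u1 u2' - u1' u2\<close> equals \<open>u1 z2 - z1 u2\<close>, because the two contributions of \<open>Q\<close>
  cancel.
\<close>

lemma wronskian_deriv:
  assumes "quasi_sol Q h1 u1 z1" "quasi_sol Q h2 u2 z2" "x \<in> {0..pi}"
  shows "((\<lambda>x. u1 x * z2 x - z1 x * u2 x) has_real_derivative (h1 x - h2 x) * (u1 x * u2 x))
           (at x within {0..pi})"
proof -
  note d = quasi_solD[OF assms(1,3)] quasi_solD[OF assms(2,3)]
  show ?thesis
    by (rule derivative_eq_intros d refl)+ (simp add: algebra_simps power2_eq_square)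
qed

section \<open>Sturm comparison of root counts\<close>

lemma DERIV_within_zero_pos_right:
  fixes u :: "real \<Rightarrow> real"
  assumes "(u has_real_derivative d) (at a within S)" "{a..b} \<subseteq> S" "a < b" "u a = 0"
    and "\<And>x. x \<in> {a<..<b} \<Longrightarrow> u x \<ge> 0"
  shows "d \<ge> 0"
proof (rule ccontr)
  assume "\<not> d \<ge> 0"
  then obtain e where e: "e > 0" "\<And>h. h > 0 \<Longrightarrow> a + h \<in> S \<Longrightarrow> h < e \<Longrightarrow> u a > u (a + h)"
    using has_real_derivative_neg_dec_right[OF assms(1)] by auto
  define h where "h = min e (b - a) / 2"
  have "h > 0" "h < e" "a + h \<in> {a<..<b}"
    using e assms(3) by (auto simp: h_def min_def field_simps)
  moreover have "a + h \<in> S" using \<open>a + h \<in> {a<..<b}\<close> assms(2) by auto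
  ultimately show False
    using e(2)[of h] assms(5)[of "a + h"] assms(4) by auto
qed

lemma DERIV_within_zero_pos_left:
  fixes u :: "real \<Rightarrow> real"
  assumes "(u has_real_derivative d) (at b within S)" "{a..b} \<subseteq> S" "a < b" "u b = 0"
    and "\<And>x. x \<in> {a<..<b} \<Longrightarrow> u x \<ge> 0"
  shows "d \<le> 0"
proof (rule ccontr)
  assume "\<not> d \<le> 0"
  then obtain e where e: "e > 0" "\<And>h. h > 0 \<Longrightarrow> b - h \<in> S \<Longrightarrow> h < e \<Longrightarrow> u (b - h) < u b"
    using has_real_derivative_pos_inc_left[OF assms(1)] by auto
  define h where "h = min e (b - a) / 2"
  have "h > 0" "h < e" "b - h \<in> {a<..<b}"
    using e assms(3) by (auto simp: h_def min_def field_simps)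
  moreover have "b - h \<in> S" using \<open>b - h \<in> {a<..<b}\<close> assms(2) by auto
  ultimately show False
    using e(2)[of h] assms(5)[of "b - h"] assms(4) by auto
qed

lemma const_sign_on_interval:
  fixes u :: "real \<Rightarrow> real"
  assumes "continuous_on {a<..<b} u" "\<And>x. x \<in> {a<..<b} \<Longrightarrow> u x \<noteq> 0"
  shows "(\<forall>x\<in>{a<..<b}. u x > 0) \<or> (\<forall>x\<in>{a<..<b}. u x < 0)"
proof (rule ccontr)
  assume "\<not> ?thesis"
  then obtain x y where xy: "x \<in> {a<..<b}" "y \<in> {a<..<b}" "u x < 0" "u y > 0"
    using assms(2) by (metis linorder_neqE_linordered_idom)
  have "connected (u ` {a<..<b})"
    using assms(1) by (intro connected_continuous_image) auto
  then have "0 \<in> u ` {a<..<b}"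
    using xy by (meson connected_contains_Icc atLeastAtMost_iff image_eqI less_imp_le subsetD)
  then show False using assms(2) by auto
qed

lemma nonneg_at_ends:
  fixes u :: "real \<Rightarrow> real"
  assumes "continuous_on {a..b} u" "a < b" "\<And>x. x \<in> {a<..<b} \<Longrightarrow> u x > 0"
  shows "u a \<ge> 0" "u b \<ge> 0"
proof -
  have cl: "closure {a<..<b} = {a..b}" using assms(2) by simp
  have "\<And>x. x \<in> {a..b} \<Longrightarrow> u x \<ge> 0"
    using continuous_ge_on_closure[of "{a<..<b}" u _ 0] assms(1,3) unfolding cl
    by (metis less_imp_le)
  then show "u a \<ge> 0" "u b \<ge> 0" using assms(2) by auto
qed

text \<open>
  The core of Sturm's comparison. If \<open>u1\<close> and \<open>u2\<close> are positive on \<open>(a, b)\<close>, then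
  \<open>W' = (h1 - h2) u1 u2 < 0\<close> there, while at each end either \<open>W = 0\<close> or \<open>u1\<close> vanishes, and then the
  sign of \<open>u1'\<close> gives \<open>W a \<le> 0 \<le> W b\<close>.
\<close>

lemma nodal_comparison_pos:
  assumes q1: "quasi_sol Q h1 u1 z1" and q2: "quasi_sol Q h2 u2 z2"
    and ab: "0 \<le> a" "a < b" "b \<le> pi"
    and pos: "\<And>x. x \<in> {a<..<b} \<Longrightarrow> u1 x > 0" "\<And>x. x \<in> {a<..<b} \<Longrightarrow> u2 x > 0"
    and less: "\<And>x. x \<in> {a<..<b} \<Longrightarrow> h1 x < h2 x"
    and enda: "u1 a = 0 \<or> u1 a * z2 a - z1 a * u2 a = 0"
    and endb: "u1 b = 0 \<or> u1 b * z2 b - z1 b * u2 b = 0"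
  shows False
proof -
  define W where "W x = u1 x * z2 x - z1 x * u2 x" for x
  have sub: "{a..b} \<subseteq> {0..pi}" using ab by auto
  have dW: "(W has_real_derivative (h1 x - h2 x) * (u1 x * u2 x)) (at x within {0..pi})"
    if "x \<in> {0..pi}" for x
    unfolding W_def using wronskian_deriv[OF q1 q2 that] .
  have cont: "continuous_on {a..b} u1" "continuous_on {a..b} u2" "continuous_on {a..b} W"
    using continuous_on_subset[OF quasi_sol_continuous(1)[OF q1] sub]
      continuous_on_subset[OF quasi_sol_continuous(1)[OF q2] sub]
      continuous_on_subset[OF DERIV_continuous_on[OF dW] sub] by auto
  have u2: "u2 a \<ge> 0" "u2 b \<ge> 0" using nonneg_at_ends[OF cont(2) ab(2) pos(2)] by auto
  have "W a \<le> 0"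
  proof (cases "u1 a = 0")
    case True
    have "z1 a + Q a * u1 a \<ge> 0"
      by (rule DERIV_within_zero_pos_right[OF quasi_solD(1)[OF q1] sub ab(2) True])
        (use ab pos(1) in \<open>auto intro: less_imp_le\<close>)
    then show ?thesis using True u2 by (simp add: W_def)
  qed (use enda in \<open>simp add: W_def\<close>)
  moreover have "W b \<ge> 0"
  proof (cases "u1 b = 0")
    case True
    have "z1 b + Q b * u1 b \<le> 0"
      by (rule DERIV_within_zero_pos_left[OF quasi_solD(1)[OF q1] sub ab(2) True])
        (use ab pos(1) in \<open>auto intro: less_imp_le\<close>)
    then show ?thesis using True u2 by (simp add: W_def mult_nonpos_nonneg)
  qed (use endb in \<open>simp add: W_def\<close>)
  moreover have "W b < W a"
  proof (rule DERIV_neg_imp_decreasing_open[OF ab(2) _ cont(3)])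
    fix x assume x: "a < x" "x < b"
    have "at x within {0..pi} = at x"
      using x ab by (intro at_within_interior) auto
    then have "(W has_real_derivative (h1 x - h2 x) * (u1 x * u2 x)) (at x)"
      using dW[of x] x ab by simp
    moreover have "(h1 x - h2 x) * (u1 x * u2 x) < 0"
      using pos less x by (simp add: mult_less_0_iff)
    ultimately show "\<exists>y. DERIV W x :> y \<and> y < 0" by blast
  qed
  ultimately show False by linarith
qed

lemma nodal_comparison:
  assumes q1: "quasi_sol Q h1 u1 z1" and q2: "quasi_sol Q h2 u2 z2"
    and ab: "0 \<le> a" "a < b" "b \<le> pi"
    and nz: "\<And>x. x \<in> {a<..<b} \<Longrightarrow> u1 x \<noteq> 0"
    and less: "\<And>x. x \<in> {a<..<b} \<Longrightarrow> u1 x \<noteq> 0 \<Longrightarrow> u2 x \<noteq> 0 \<Longrightarrow> h1 x < h2 x"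
    and enda: "u1 a = 0 \<or> u1 a * z2 a - z1 a * u2 a = 0"
    and endb: "u1 b = 0 \<or> u1 b * z2 b - z1 b * u2 b = 0"
  shows "\<exists>x\<in>{a<..<b}. u2 x = 0"
proof (rule ccontr)
  assume neg: "\<not> ?thesis"
  have sub: "{a<..<b} \<subseteq> {0..pi}" using ab by auto
  note c1 = continuous_on_subset[OF quasi_sol_continuous(1)[OF q1] sub]
  note c2 = continuous_on_subset[OF quasi_sol_continuous(1)[OF q2] sub]
  have less': "h1 x < h2 x" if "x \<in> {a<..<b}" for x using less nz neg that by blast
  have s1: "(\<forall>x\<in>{a<..<b}. u1 x > 0) \<or> (\<forall>x\<in>{a<..<b}. u1 x < 0)"
    using const_sign_on_interval[OF c1 nz] by blast
  have s2: "(\<forall>x\<in>{a<..<b}. u2 x > 0) \<or> (\<forall>x\<in>{a<..<b}. u2 x < 0)"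
    using const_sign_on_interval[OF c2] neg by blast
  note m1 = quasi_sol_uminus[OF q1] and m2 = quasi_sol_uminus[OF q2]
  from s1 s2 show False
    using nodal_comparison_pos[OF q1 q2 ab _ _ less'] nodal_comparison_pos[OF m1 q2 ab _ _ less']
      nodal_comparison_pos[OF q1 m2 ab _ _ less'] nodal_comparison_pos[OF m1 m2 ab _ _ less']
      enda endb
    by (elim disjE) (simp_all add: algebra_simps)
qed

text \<open>
  The boundary conditions in terms of the quasi-derivative, with \<open>u' = z + Q u\<close>.
\<close>

definition quasi_bc ::
  "real \<Rightarrow> (real \<Rightarrow> real) \<Rightarrow> (real \<Rightarrow> real) \<Rightarrow> (real \<Rightarrow> real) \<Rightarrow> bool" where
  "quasi_bc \<alpha> Q u z \<longleftrightarrow> separated_bc \<alpha> u (\<lambda>x. z x + Q x * u x)"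

lemma proportional_zero:
  fixes u1 u2 v1 v2 \<alpha> :: real
  assumes "u1 * cos \<alpha> + v1 * sin \<alpha> = 0" "u2 * cos \<alpha> + v2 * sin \<alpha> = 0"
  shows "u1 * v2 - v1 * u2 = 0"
proof -
  have "(u1 * v2 - v1 * u2) * cos \<alpha> = 0" "(u1 * v2 - v1 * u2) * sin \<alpha> = 0"
    using assms by algebra+
  moreover have "cos \<alpha> \<noteq> 0 \<or> sin \<alpha> \<noteq> 0" using sin_zero_abs_cos_one[of \<alpha>] by auto
  ultimately show ?thesis by (metis mult_eq_0_iff)
qed

lemma wronskian_ends:
  assumes "quasi_bc \<alpha> Q u1 z1" "quasi_bc \<alpha> Q u2 z2"
  shows "u1 0 * z2 0 - z1 0 * u2 0 = 0" "u1 pi * z2 pi - z1 pi * u2 pi = 0"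
  using proportional_zero[of "u1 0" \<alpha> "z1 0 + Q 0 * u1 0" "u2 0" "z2 0 + Q 0 * u2 0"]
    proportional_zero[of "u1 pi" \<alpha> "z1 pi + Q pi * u1 pi" "u2 pi" "z2 pi + Q pi * u2 pi"] assms
  by (auto simp: quasi_bc_def separated_bc_def algebra_simps)

text \<open>
  Cut \<open>[0, pi]\<close> at the \<open>n\<close> roots of \<open>u1\<close>. Each of the \<open>n + 1\<close> pieces contains a root of \<open>u2\<close> in its
  interior; for the two outer pieces this is where the common boundary conditions enter.
\<close>

lemma sturm_comparison_card:
  assumes q1: "quasi_sol Q h1 u1 z1" and q2: "quasi_sol Q h2 u2 z2"
    and bc: "quasi_bc \<alpha> Q u1 z1" "quasi_bc \<alpha> Q u2 z2"
    and less: "\<And>x. x \<in> {0<..<pi} \<Longrightarrow> u1 x \<noteq> 0 \<Longrightarrow> u2 x \<noteq> 0 \<Longrightarrow> h1 x < h2 x"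
    and fin: "finite (roots_0pi u1)" "finite (roots_0pi u2)"
  shows "card (roots_0pi u1) < card (roots_0pi u2)"
proof -
  \<comment> \<open>\<open>P\<close> holds the left ends of the nodal intervals, and \<open>N p\<close> is the right end of the one starting at \<open>p\<close>.\<close>
  define P where "P = insert 0 (roots_0pi u1)"
  define N where "N p = Min {r \<in> insert pi (roots_0pi u1). p < r}" for p
  have rsub: "x \<in> roots_0pi u1 \<Longrightarrow> 0 < x \<and> x < pi \<and> u1 x = 0" for x
    by (auto simp: roots_0pi_def)
  have N: "N p \<in> insert pi (roots_0pi u1)" "p < N p"
    "\<And>r. r \<in> roots_0pi u1 \<Longrightarrow> p < r \<Longrightarrow> N p \<le> r" if "p \<in> P" for p
  proof -
    have f: "finite {r \<in> insert pi (roots_0pi u1). p < r}" using fin by auto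
    have "pi \<in> {r \<in> insert pi (roots_0pi u1). p < r}"
      using that rsub by (auto simp: P_def)
    then have "N p \<in> {r \<in> insert pi (roots_0pi u1). p < r}"
      unfolding N_def using f by (intro Min_in) auto
    then show "N p \<in> insert pi (roots_0pi u1)" "p < N p" by auto
    show "N p \<le> r" if "r \<in> roots_0pi u1" "p < r" for r
      unfolding N_def using f that by (intro Min_le) auto
  qed
  have "\<exists>x\<in>{p<..<N p}. u2 x = 0" if p: "p \<in> P" for p
  proof (rule nodal_comparison[OF q1 q2])
    show p0: "0 \<le> p" "p < N p" "N p \<le> pi"
      using p N[OF p] rsub by (auto simp: P_def intro: less_imp_le)
    show "u1 x \<noteq> 0" if "x \<in> {p<..<N p}" for x
      using N(3)[OF p, of x] that p0 by (force simp: roots_0pi_def)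
    show "h1 x < h2 x" if "x \<in> {p<..<N p}" "u1 x \<noteq> 0" "u2 x \<noteq> 0" for x
      using less[of x] that p0 by auto
    show "u1 p = 0 \<or> u1 p * z2 p - z1 p * u2 p = 0"
      using p wronskian_ends[OF bc] rsub by (auto simp: P_def)
    show "u1 (N p) = 0 \<or> u1 (N p) * z2 (N p) - z1 (N p) * u2 (N p) = 0"
      using N(1)[OF p] wronskian_ends[OF bc] rsub by auto
  qed
  then obtain f where f: "\<And>p. p \<in> P \<Longrightarrow> f p \<in> {p<..<N p} \<and> u2 (f p) = 0" by metis
  have lt: "f p < f p'" if "p \<in> P" "p' \<in> P" "p < p'" for p p'
  proof -
    have "p' \<in> roots_0pi u1" using that rsub[of p] by (auto simp: P_def)
    then have "N p \<le> p'" using N(3)[OF that(1)] that(3) by blast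
    then show ?thesis using f[OF that(1)] f[OF that(2)] by auto
  qed
  have "inj_on f P" by (rule linorder_inj_onI) (use lt in force)+
  moreover have "f ` P \<subseteq> roots_0pi u2"
  proof
    fix y assume "y \<in> f ` P"
    then obtain p where p: "p \<in> P" "y = f p" by auto
    have "0 \<le> p" "N p \<le> pi" using p N[OF p(1)] rsub by (auto simp: P_def intro: less_imp_le)
    then show "y \<in> roots_0pi u2" using f[OF p(1)] p by (auto simp: roots_0pi_def)
  qed
  ultimately have "card P \<le> card (roots_0pi u2)" using fin(2) by (metis card_inj_on_le)
  moreover have "card P = Suc (card (roots_0pi u1))"
    unfolding P_def using fin(1) rsub by (subst card_insert_disjoint) auto
  ultimately show ?thesis by simp
qed

section \<open>Uniqueness and finiteness of the roots\<close>

text \<open>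
  Uniqueness: \<open>E = u\<^sup>2 + z\<^sup>2\<close> satisfies \<open>\<bar>E'\<bar> \<le> K E\<close>, so \<open>E exp (K x)\<close> is nondecreasing and
  \<open>E exp (- K x)\<close> is nonincreasing; if \<open>E\<close> vanishes at one point, it vanishes on both sides of it.
\<close>

lemma quasi_sol_double_zero:
  assumes q: "quasi_sol Q h u z" and cQ: "continuous_on {0..pi} Q" and ch: "continuous_on {0..pi} h"
    and c: "c \<in> {0..pi}" "u c = 0" "z c = 0" and x: "x \<in> {0..pi}"
  shows "u x = 0"
proof -
  define E where "E x = (u x)\<^sup>2 + (z x)\<^sup>2" for x
  define g where "g x = 1 + \<bar>h x\<bar> + (Q x)\<^sup>2 + 2 * \<bar>Q x\<bar>" for x
  have "continuous_on {0..pi} g" unfolding g_def by (intro continuous_intros cQ ch)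
  then have "bounded (g ` {0..pi})" by (intro compact_imp_bounded compact_continuous_image) auto
  then obtain K where K: "\<And>x. x \<in> {0..pi} \<Longrightarrow> \<bar>g x\<bar> \<le> K"
    unfolding bounded_iff by force
  define e where "e x = 2 * (Q x * (u x)\<^sup>2 + (1 - h x - (Q x)\<^sup>2) * (u x * z x) - Q x * (z x)\<^sup>2)" for x
  have dE: "(E has_real_derivative e x) (at x within {0..pi})" if "x \<in> {0..pi}" for x
    unfolding E_def e_def
    by (rule derivative_eq_intros quasi_solD[OF q that] refl)+
      (simp add: algebra_simps power2_eq_square)
  have eb: "\<bar>e x\<bar> \<le> K * E x" if "x \<in> {0..pi}" for x
  proof -
    have E0: "0 \<le> E x" "(u x)\<^sup>2 \<le> E x" "(z x)\<^sup>2 \<le> E x" by (auto simp: E_def)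
    have uz: "2 * \<bar>u x * z x\<bar> \<le> E x"
      using zero_le_power2[of "\<bar>u x\<bar> - \<bar>z x\<bar>"] by (simp add: E_def power2_diff abs_mult)
    have "\<bar>e x\<bar> \<le> \<bar>2 * Q x * ((u x)\<^sup>2 - (z x)\<^sup>2)\<bar> + \<bar>(1 - h x - (Q x)\<^sup>2) * (2 * (u x * z x))\<bar>"
      unfolding e_def by (rule order_trans[OF _ abs_triangle_ineq]) (simp add: algebra_simps)
    also have "\<dots> \<le> 2 * \<bar>Q x\<bar> * E x + (1 + \<bar>h x\<bar> + (Q x)\<^sup>2) * E x"
    proof (rule add_mono)
      show "\<bar>2 * Q x * ((u x)\<^sup>2 - (z x)\<^sup>2)\<bar> \<le> 2 * \<bar>Q x\<bar> * E x"
      proof -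
        have "\<bar>(u x)\<^sup>2 - (z x)\<^sup>2\<bar> \<le> E x"
          using zero_le_power2[of "u x"] zero_le_power2[of "z x"] unfolding E_def by linarith
        then show ?thesis
          unfolding abs_mult[of "2 * Q x"] by (intro mult_mono) (auto simp: abs_mult)
      qed
      have "\<bar>1 - h x - (Q x)\<^sup>2\<bar> \<le> 1 + \<bar>h x\<bar> + (Q x)\<^sup>2" by (smt (verit) zero_le_power2)
      then show "\<bar>(1 - h x - (Q x)\<^sup>2) * (2 * (u x * z x))\<bar> \<le> (1 + \<bar>h x\<bar> + (Q x)\<^sup>2) * E x"
        using uz E0 unfolding abs_mult[of "1 - h x - (Q x)\<^sup>2"]
        by (intro mult_mono) (auto simp: abs_mult)
    qed
    also have "\<dots> = g x * E x" by (simp add: g_def algebra_simps)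
    also have "\<dots> \<le> K * E x" using K[OF that] E0(1) by (intro mult_right_mono) auto
    finally show ?thesis .
  qed
  have mono: "\<sigma> * (E x * exp (\<sigma> * K * x)) \<le> \<sigma> * (E y * exp (\<sigma> * K * y))"
    if xy: "x \<in> {0..pi}" "y \<in> {0..pi}" "x \<le> y" and \<sigma>: "\<sigma> = 1 \<or> \<sigma> = -1" for x y \<sigma> :: real
  proof -
    define F where "F t = \<sigma> * (E t * exp (\<sigma> * K * t))" for t
    have dF: "(F has_real_derivative \<sigma> * ((e t + \<sigma> * K * E t) * exp (\<sigma> * K * t)))
                (at t within {0..pi})" if "t \<in> {0..pi}" for t
      unfolding F_def by (rule derivative_eq_intros dE[OF that] refl)+ (simp add: algebra_simps)
    have "F x \<le> F y"
    proof (rule DERIV_nonneg_imp_increasing_open[OF xy(3)])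
      fix t assume t: "x < t" "t < y"
      then have t0: "t \<in> {0..pi}" using xy by auto
      have "at t within {0..pi} = at t" using t xy by (intro at_within_interior) auto
      then have "DERIV F t :> \<sigma> * ((e t + \<sigma> * K * E t) * exp (\<sigma> * K * t))"
        using dF[OF t0] by simp
      moreover have "\<sigma> * (e t + \<sigma> * K * E t) \<ge> 0" using eb[OF t0] \<sigma> by auto
      then have "\<sigma> * ((e t + \<sigma> * K * E t) * exp (\<sigma> * K * t)) \<ge> 0"
        by (metis exp_ge_zero mult.assoc mult_nonneg_nonneg)
      ultimately show "\<exists>d. DERIV F t :> d \<and> d \<ge> 0" by blast
    next
      show "continuous_on {x..y} F"
        using continuous_on_subset[OF DERIV_continuous_on[OF dF], of "{x..y}"] xy by auto
    qed
    then show ?thesis by (simp add: F_def)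
  qed
  have "E c = 0" using c by (simp add: E_def)
  then have "E x \<le> 0"
    using mono[of c x "-1"] mono[of x c 1] c x
    by (cases "c \<le> x") (auto simp: mult_le_0_iff zero_le_mult_iff)
  then show ?thesis by (simp add: E_def sum_power2_le_zero_iff)
qed

text \<open>
  Infinitely many roots would accumulate at a point where \<open>u = u' = 0\<close>.
\<close>

lemma quasi_sol_finite_roots:
  assumes q: "quasi_sol Q h u z" and cQ: "continuous_on {0..pi} Q" and ch: "continuous_on {0..pi} h"
    and nz: "nonzero_0pi u"
  shows "finite (roots_0pi u)"
proof (rule ccontr)
  assume inf: "infinite (roots_0pi u)"
  have "roots_0pi u \<subseteq> {0..pi}" by (auto simp: roots_0pi_def)
  then obtain c where c: "c \<in> {0..pi}" "c islimpt roots_0pi u"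
    using inf compact_eq_Bolzano_Weierstrass[of "{0..pi}"] by blast
  have lim: "at c within roots_0pi u \<noteq> bot" using c(2) by (simp add: trivial_limit_within)
  have sub: "at c within roots_0pi u \<le> at c within {0..pi}"
    by (intro at_le) (auto simp: roots_0pi_def)
  have ev: "\<forall>\<^sub>F x in at c within roots_0pi u. u x = 0"
    by (auto simp: eventually_at_filter roots_0pi_def)
  have "(u \<longlongrightarrow> u c) (at c within {0..pi})"
    using quasi_sol_continuous(1)[OF q] c(1) by (auto simp: continuous_on_def)
  then have "(u \<longlongrightarrow> u c) (at c within roots_0pi u)" using sub tendsto_mono by blast
  then have "((\<lambda>x. 0) \<longlongrightarrow> u c) (at c within roots_0pi u)"
    using tendsto_cong[OF ev] by blast
  then have uc: "u c = 0" using tendsto_unique[OF lim _ tendsto_const] by blast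
  have "((\<lambda>x. (u x - u c) / (x - c)) \<longlongrightarrow> z c + Q c * u c) (at c within {0..pi})"
    using quasi_solD(1)[OF q c(1)] by (simp add: has_field_derivative_iff)
  then have "((\<lambda>x. (u x - u c) / (x - c)) \<longlongrightarrow> z c) (at c within roots_0pi u)"
    using sub tendsto_mono uc by fastforce
  moreover have "\<forall>\<^sub>F x in at c within roots_0pi u. (u x - u c) / (x - c) = 0"
    using ev by eventually_elim (simp add: uc)
  ultimately have "((\<lambda>x. 0) \<longlongrightarrow> z c) (at c within roots_0pi u)"
    by (rule Lim_transform_eventually)
  then have "z c = 0" using tendsto_unique[OF lim _ tendsto_const] by blast
  then show False
    using quasi_sol_double_zero[OF q cQ ch c(1) uc] nz by (auto simp: nonzero_0pi_def)
qed

section \<open>Integration by parts for an integrable function\<close>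

text \<open>
  If for every \<open>\<epsilon> > 0\<close> the increments of \<open>F\<close> over short intervals are bounded by \<open>\<epsilon>\<close> times those of a
  fixed \<open>H\<close>, then \<open>F\<close> takes the same value at both ends. This replaces differentiation almost everywhere in
  the product rule below.
\<close>

lemma additive_small_imp_const:
  fixes F H :: "real \<Rightarrow> real"
  assumes ab: "a \<le> b"
    and small: "\<And>\<epsilon>. \<epsilon> > 0 \<Longrightarrow> \<exists>\<delta>>0. \<forall>x y. a \<le> x \<longrightarrow> x \<le> y \<longrightarrow> y \<le> b \<longrightarrow> y - x < \<delta> \<longrightarrow>
                   \<bar>F y - F x\<bar> \<le> \<epsilon> * (H y - H x)"
  shows "F b = F a"
proof -
  have le: "\<bar>F b - F a\<bar> \<le> \<epsilon> * (H b - H a)" if \<epsilon>: "\<epsilon> > 0" for \<epsilon>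
  proof -
    obtain \<delta> where \<delta>: "\<delta> > 0" "\<And>x y. a \<le> x \<Longrightarrow> x \<le> y \<Longrightarrow> y \<le> b \<Longrightarrow> y - x < \<delta> \<Longrightarrow>
        \<bar>F y - F x\<bar> \<le> \<epsilon> * (H y - H x)" using small[OF \<epsilon>] by blast
    obtain N :: nat where N: "(b - a) / \<delta> < real N" using reals_Archimedean2 by blast
    then have N0: "N > 0" using ab \<delta>(1) by (metis divide_nonneg_pos diff_ge_0_iff_ge gr0I not_less of_nat_0)
    define p where "p i = a + real i * ((b - a) / N)" for i
    have step: "p (Suc i) - p i = (b - a) / N" for i
      unfolding p_def of_nat_Suc distrib_right by simp
    have "(b - a) / N < \<delta>" using N N0 \<delta>(1) by (simp add: field_simps)
    have "\<bar>F (p n) - F a\<bar> \<le> \<epsilon> * (H (p n) - H a)" if "n \<le> N" for n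
      using that
    proof (induction n)
      case 0 then show ?case by (simp add: p_def)
    next
      case (Suc n)
      have 1: "a \<le> p n" using ab by (simp add: p_def)
      have 2: "p n \<le> p (Suc n)" using step[of n] ab by (smt (verit) divide_nonneg_nonneg of_nat_0_le_iff)
      have "real (Suc n) * ((b - a) / N) \<le> real N * ((b - a) / N)"
        using Suc.prems ab by (intro mult_right_mono) auto
      then have 3: "p (Suc n) \<le> b" using N0 by (simp add: p_def)
      have "\<bar>F (p (Suc n)) - F (p n)\<bar> \<le> \<epsilon> * (H (p (Suc n)) - H (p n))"
        by (rule \<delta>(2)[OF 1 2 3]) (simp add: step \<open>(b - a) / N < \<delta>\<close>)
      then show ?case using Suc by (simp add: algebra_simps)
    qed
    from this[of N] show ?thesis using N0 by (simp add: p_def)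
  qed
  have "\<bar>F b - F a\<bar> \<le> 0"
  proof (cases "H b - H a \<le> 0")
    case True then show ?thesis using le[of 1] by simp
  next
    case False
    show ?thesis
    proof (rule field_le_epsilon)
      fix e :: real assume "e > 0"
      then show "\<bar>F b - F a\<bar> \<le> 0 + e" using le[of "e / (H b - H a)"] False by simp
    qed
  qed
  then show ?thesis by simp
qed

lemma abs_integrable_mult_continuous:
  fixes q u :: "real \<Rightarrow> real"
  assumes "q absolutely_integrable_on {a..b}" "continuous_on {a..b} u"
  shows "(\<lambda>t. u t * q t) absolutely_integrable_on {a..b}"
proof (rule absolutely_integrable_bounded_measurable_product_real)
  show "u \<in> borel_measurable (lebesgue_on {a..b})"
    by (intro continuous_imp_measurable_on_sets_lebesgue assms) auto
  show "bounded (u ` {a..b})" by (intro compact_imp_bounded compact_continuous_image assms) auto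
qed (use assms in auto)

text \<open>
  Integration by parts for a primitive \<open>Q\<close> of an integrable function and a \<open>C\<^sup>1\<close> function \<open>u\<close>. On \<open>[x, y]\<close>
  the defect \<open>F\<close> of the formula changes by the integral of
  \<open>(Q y - Q t) v t + (u x - u t) q t\<close>, which is small by uniform continuity of \<open>Q\<close> and \<open>u\<close>.
\<close>

lemma integral_by_parts_primitive:
  fixes q u v :: "real \<Rightarrow> real"
  assumes q: "q absolutely_integrable_on {a..b}"
    and u: "\<And>t. t \<in> {a..b} \<Longrightarrow> (u has_real_derivative v t) (at t within {a..b})"
    and v: "continuous_on {a..b} v"
    and ab: "a \<le> b"
  defines "Q \<equiv> \<lambda>x. integral {a..x} q"
  shows "Q b * u b = integral {a..b} (\<lambda>t. u t * q t) + integral {a..b} (\<lambda>t. Q t * v t)"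
proof -
  have iq: "q integrable_on {a..b}" using q by (simp add: absolutely_integrable_on_def)
  have inq: "(\<lambda>t. \<bar>q t\<bar>) integrable_on {a..b}" using q by (simp add: absolutely_integrable_on_def)
  have cu: "continuous_on {a..b} u" using u by (rule DERIV_continuous_on)
  have cQ: "continuous_on {a..b} Q" unfolding Q_def by (rule indefinite_integral_continuous_1[OF iq])
  have iuq: "(\<lambda>t. u t * q t) integrable_on {a..b}"
    using abs_integrable_mult_continuous[OF q cu] by (simp add: absolutely_integrable_on_def)
  have iQv: "(\<lambda>t. Q t * v t) integrable_on {a..b}"
    by (intro integrable_continuous_real continuous_intros cQ v)
  define F where "F x = Q x * u x - integral {a..x} (\<lambda>t. u t * q t) - integral {a..x} (\<lambda>t. Q t * v t)" for x
  define H where "H x = x + integral {a..x} (\<lambda>t. \<bar>q t\<bar>)" for x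
  have split: "integral {a..y} g - integral {a..x} g = integral {x..y} g"
    if "g integrable_on {a..b}" "a \<le> x" "x \<le> y" "y \<le> b" for g :: "real \<Rightarrow> real" and x y
    using Henstock_Kurzweil_Integration.integral_combine[of a x y g]
      integrable_on_subinterval[OF that(1), of a y] that by auto
  have "bounded (v ` {a..b})" by (intro compact_imp_bounded compact_continuous_image v) auto
  then obtain V where V: "V > 0" "\<And>t. t \<in> {a..b} \<Longrightarrow> \<bar>v t\<bar> \<le> V"
    unfolding bounded_pos by auto
  have "F b = F a"
  proof (rule additive_small_imp_const[where H = H, OF ab])
    fix \<epsilon> :: real assume \<epsilon>: "\<epsilon> > 0"
    have "uniformly_continuous_on {a..b} Q" "uniformly_continuous_on {a..b} u"
      using cQ cu by (auto intro: compact_uniformly_continuous)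
    then obtain d1 d2 where d: "d1 > 0" "d2 > 0"
      "\<And>s t. s \<in> {a..b} \<Longrightarrow> t \<in> {a..b} \<Longrightarrow> dist t s < d1 \<Longrightarrow> dist (Q t) (Q s) < \<epsilon> / V"
      "\<And>s t. s \<in> {a..b} \<Longrightarrow> t \<in> {a..b} \<Longrightarrow> dist t s < d2 \<Longrightarrow> dist (u t) (u s) < \<epsilon>"
      unfolding uniformly_continuous_on_def using \<epsilon> V(1) by (metis divide_pos_pos)
    show "\<exists>\<delta>>0. \<forall>x y. a \<le> x \<longrightarrow> x \<le> y \<longrightarrow> y \<le> b \<longrightarrow> y - x < \<delta> \<longrightarrow>
            \<bar>F y - F x\<bar> \<le> \<epsilon> * (H y - H x)"
    proof (intro exI[of _ "min d1 d2"] conjI allI impI)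
      show "min d1 d2 > 0" using d by simp
      fix x y assume xy: "a \<le> x" "x \<le> y" "y \<le> b" and lt: "y - x < min d1 d2"
      have sub: "{x..y} \<subseteq> {a..b}" using xy by auto
      note ints = integrable_on_subinterval[OF _ sub]
      have v1: "(v has_integral (u y - u x)) {x..y}"
        using fundamental_theorem_of_calculus[OF xy(2), of u v] u sub
        by (metis DERIV_subset has_real_derivative_iff_has_vector_derivative subsetD)
      have i1: "((\<lambda>t. (Q y - Q t) * v t) has_integral
                  Q y * (u y - u x) - integral {x..y} (\<lambda>t. Q t * v t)) {x..y}"
        using has_integral_diff[OF has_integral_mult_right[OF v1, of "Q y"]
            integrable_integral[OF ints[OF iQv]]] by (simp add: algebra_simps)
      have i2: "((\<lambda>t. (u x - u t) * q t) has_integral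
                  u x * (Q y - Q x) - integral {x..y} (\<lambda>t. u t * q t)) {x..y}"
        using has_integral_diff[OF has_integral_mult_right[OF integrable_integral[OF ints[OF iq]], of "u x"]
            integrable_integral[OF ints[OF iuq]]] split[OF iq xy]
        by (simp add: algebra_simps Q_def)
      have "F y - F x = integral {x..y} (\<lambda>t. (Q y - Q t) * v t) + integral {x..y} (\<lambda>t. (u x - u t) * q t)"
        using split[OF iuq xy] split[OF iQv xy]
        unfolding F_def integral_unique[OF i1] integral_unique[OF i2]
        by (simp add: right_diff_distrib left_diff_distrib)
      moreover have "\<bar>integral {x..y} (\<lambda>t. (Q y - Q t) * v t)\<bar> \<le> integral {x..y} (\<lambda>t. \<epsilon>)"
      proof (rule integral_norm_bound_integral[where 'a = real, unfolded real_norm_def])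
        fix t assume t: "t \<in> {x..y}"
        then have "\<bar>Q y - Q t\<bar> \<le> \<epsilon> / V" "\<bar>v t\<bar> \<le> V"
          using d(3)[of t y] V(2)[of t] xy lt by (auto simp: dist_real_def)
        then have "\<bar>Q y - Q t\<bar> * \<bar>v t\<bar> \<le> \<epsilon> / V * V" using \<epsilon> V(1) by (intro mult_mono) auto
        then show "\<bar>(Q y - Q t) * v t\<bar> \<le> \<epsilon>" using V(1) by (simp add: abs_mult)
      qed (use i1 in auto)
      moreover have "\<bar>integral {x..y} (\<lambda>t. (u x - u t) * q t)\<bar> \<le> integral {x..y} (\<lambda>t. \<epsilon> * \<bar>q t\<bar>)"
      proof (rule integral_norm_bound_integral[where 'a = real, unfolded real_norm_def])
        show "(\<lambda>t. \<epsilon> * \<bar>q t\<bar>) integrable_on {x..y}"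
          by (intro integrable_on_mult_right ints[OF inq])
        fix t assume t: "t \<in> {x..y}"
        then have "\<bar>u x - u t\<bar> \<le> \<epsilon>"
          using d(4)[of t x] xy lt by (auto simp: dist_real_def)
        then show "\<bar>(u x - u t) * q t\<bar> \<le> \<epsilon> * \<bar>q t\<bar>" by (simp add: abs_mult mult_right_mono)
      qed (use i2 in auto)
      moreover have "integral {x..y} (\<lambda>t. \<epsilon>) + integral {x..y} (\<lambda>t. \<epsilon> * \<bar>q t\<bar>) = \<epsilon> * (H y - H x)"
        using split[OF inq xy] xy by (simp add: H_def algebra_simps)
      ultimately show "\<bar>F y - F x\<bar> \<le> \<epsilon> * (H y - H x)" by linarith
    qed
  qed
  then show ?thesis by (simp add: F_def Q_def)
qed

corollary integral_by_parts_primitive_upto: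
  fixes q u v :: "real \<Rightarrow> real"
  assumes q: "q absolutely_integrable_on {a..b}"
    and u: "\<And>t. t \<in> {a..b} \<Longrightarrow> (u has_real_derivative v t) (at t within {a..b})"
    and v: "continuous_on {a..b} v"
    and x: "x \<in> {a..b}"
  shows "integral {a..x} q * u x =
           integral {a..x} (\<lambda>t. u t * q t) + integral {a..x} (\<lambda>t. integral {a..t} q * v t)"
proof (rule integral_by_parts_primitive)
  have sub: "{a..x} \<subseteq> {a..b}" using x by auto
  show "q absolutely_integrable_on {a..x}"
    by (rule absolutely_integrable_on_subinterval[OF q sub])
  show "(u has_real_derivative v t) (at t within {a..x})" if "t \<in> {a..x}" for t
    using DERIV_subset[OF u sub] that sub by blast
  show "continuous_on {a..x} v" using v sub by (rule continuous_on_subset)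
qed (use x in auto)

section \<open>Operator solutions and the quasi-derivative system\<close>

lemma L2_0pi_absolutely_integrable:
  assumes "q \<in> L2_0pi"
  shows "q absolutely_integrable_on {0..pi}"
proof -
  let ?M = "lebesgue_on {0<..<pi::real}"
  have q: "q \<in> borel_measurable ?M" "integrable ?M (\<lambda>x. (q x)\<^sup>2)"
    using assms by (auto simp: L2_0pi_def)
  have "finite_measure ?M" by (intro finite_measure_lebesgue_on) auto
  then have "integrable ?M (\<lambda>x. 1 + (q x)\<^sup>2)"
    by (intro Bochner_Integration.integrable_add q finite_measure.integrable_const)
  then have "integrable ?M (\<lambda>x. \<bar>q x\<bar>)"
  proof (rule Bochner_Integration.integrable_bound)
    show "AE x in ?M. norm \<bar>q x\<bar> \<le> norm (1 + (q x)\<^sup>2)"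
    proof (rule AE_I2)
      fix x
      have "0 \<le> (\<bar>q x\<bar> - 1)\<^sup>2" by simp
      then have "2 * \<bar>q x\<bar> \<le> 1 + (q x)\<^sup>2" unfolding power2_diff by simp
      then show "norm \<bar>q x\<bar> \<le> norm (1 + (q x)\<^sup>2)" by simp
    qed
  qed (use q in simp)
  then have "q absolutely_integrable_on box 0 pi"
    using q(1) by (simp add: absolutely_integrable_measurable_real)
  then show ?thesis unfolding absolutely_integrable_on_open_interval by simp
qed

lemma L2_0pi_primitive_continuous:
  assumes "q \<in> L2_0pi"
  shows "continuous_on {0..pi} (\<lambda>x. integral {0..x} q)"
  using L2_0pi_absolutely_integrable[OF assms]
  by (intro indefinite_integral_continuous_1) (simp add: absolutely_integrable_on_def)

lemma set_lebesgue_integral_eq_integral_Icc: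
  fixes w :: "real \<Rightarrow> real"
  assumes "w absolutely_integrable_on {0..b}" "x \<in> {0..b}"
  shows "(LINT t:{0<..<x}|lebesgue. w t) = integral {0..x} w"
proof -
  have "set_integrable lebesgue {0<..<x} w"
    by (rule set_integrable_subset[OF assms(1)]) (use assms(2) in auto)
  then show ?thesis
    by (simp add: set_lebesgue_integral_eq_integral integral_open_interval_real)
qed

lemma integral_cong_AE_open:
  fixes f g :: "real \<Rightarrow> real"
  assumes "AE t in lebesgue_on {0<..<b}. f t = g t" "x \<in> {0..b}"
  shows "integral {0..x} f = integral {0..x} g"
proof -
  obtain N where N: "N \<in> null_sets (lebesgue_on {0<..<b})"
    "\<And>t. t \<in> {0<..<b} - N \<Longrightarrow> f t = g t"
    using AE_E3[OF assms(1)] by (metis space_lebesgue_on)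
  then have "negligible N" by (simp add: negligible_iff_null_sets null_sets_restrict_space)
  then have "negligible (N \<union> {0, b})" by (intro negligible_Un) auto
  then show ?thesis
  proof (rule integral_spike)
    fix t assume "t \<in> {0..x} - (N \<union> {0, b})"
    then have "t \<in> {0<..<b} - N" using assms(2) by auto
    then show "g t = f t" by (rule N(2)[symmetric])
  qed
qed

text \<open>
  By parts, \<open>Q u = \<integral> (q u + Q u')\<close>, and \<open>u' = u' 0 + \<integral> (q u - h u)\<close>; subtracting gives
  \<open>z = u' 0 - \<integral> (h u + Q u')\<close>, the primitive of a continuous function.
\<close>

lemma SL_operator_imp_quasi_sol:
  assumes q: "q \<in> L2_0pi" and h: "continuous_on {0..pi} h"
    and op: "SL_operator \<alpha> q u (\<lambda>x. h x * u x)"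
  defines "Q \<equiv> \<lambda>x. integral {0..x} q"
  shows "\<exists>z. quasi_sol Q h u z \<and> quasi_bc \<alpha> Q u z"
proof -
  obtain v w where vw: "W22_0pi u v w" "separated_bc \<alpha> u v"
    "AE x in lebesgue_on {0<..<pi}. - w x + q x * u x = h x * u x"
    using op unfolding SL_operator_def by blast
  have du: "(u has_real_derivative v x) (at x within {0..pi})" if "x \<in> {0..pi}" for x
    using vw(1) that unfolding W22_0pi_def by blast
  have cu: "continuous_on {0..pi} u" using du by (rule DERIV_continuous_on)
  have aq: "q absolutely_integrable_on {0..pi}" by (rule L2_0pi_absolutely_integrable[OF q])
  have aw: "w absolutely_integrable_on {0..pi}"
    using vw(1) unfolding W22_0pi_def by (blast intro: L2_0pi_absolutely_integrable)
  have v: "v x = v 0 + integral {0..x} w" if "x \<in> {0..pi}" for x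
    using vw(1) that unfolding W22_0pi_def set_lebesgue_integral_eq_integral_Icc[OF aw that, symmetric]
    by blast
  have "continuous_on {0..pi} (\<lambda>x. v 0 + integral {0..x} w)"
    by (intro continuous_intros indefinite_integral_continuous_1)
      (use aw in \<open>simp add: absolutely_integrable_on_def\<close>)
  then have cv: "continuous_on {0..pi} v" by (rule continuous_on_eq) (rule v[symmetric])
  have cQ: "continuous_on {0..pi} Q"
    unfolding Q_def by (rule L2_0pi_primitive_continuous[OF q])
  define z where "z x = v x - Q x * u x" for x
  have z: "z x = v 0 - integral {0..x} (\<lambda>t. h t * u t + Q t * v t)" if x: "x \<in> {0..pi}" for x
  proof -
    have sub: "{0..x} \<subseteq> {0..pi}" using x by auto
    have 1: "Q x * u x = integral {0..x} (\<lambda>t. u t * q t) + integral {0..x} (\<lambda>t. Q t * v t)"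
      unfolding Q_def by (rule integral_by_parts_primitive_upto[OF aq du cv x])
    have iuq: "(\<lambda>t. u t * q t) integrable_on {0..x}"
      using absolutely_integrable_on_subinterval[OF abs_integrable_mult_continuous[OF aq cu] sub]
      by (simp add: absolutely_integrable_on_def)
    have ihu: "(\<lambda>t. h t * u t) integrable_on {0..x}"
      by (intro integrable_continuous_real continuous_intros continuous_on_subset[OF h sub]
          continuous_on_subset[OF cu sub])
    have iQv: "(\<lambda>t. Q t * v t) integrable_on {0..x}"
      by (intro integrable_continuous_real continuous_intros continuous_on_subset[OF cQ sub]
          continuous_on_subset[OF cv sub])
    have "AE t in lebesgue_on {0<..<pi}. w t = u t * q t - h t * u t"
      using vw(3) by eventually_elim (simp add: algebra_simps)
    then have "integral {0..x} w = integral {0..x} (\<lambda>t. u t * q t - h t * u t)"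
      using x by (rule integral_cong_AE_open)
    also have "\<dots> = integral {0..x} (\<lambda>t. u t * q t) - integral {0..x} (\<lambda>t. h t * u t)"
      by (rule Henstock_Kurzweil_Integration.integral_diff[OF iuq ihu])
    finally show ?thesis
      using 1 v[OF x] Henstock_Kurzweil_Integration.integral_add[OF ihu iQv]
      unfolding z_def by linarith
  qed
  have "quasi_sol Q h u z"
    unfolding quasi_sol_def
  proof (intro ballI conjI)
    fix x assume x: "x \<in> {0..pi}"
    show "(u has_real_derivative z x + Q x * u x) (at x within {0..pi})"
      using du[OF x] by (simp add: z_def)
    have "((\<lambda>x. integral {0..x} (\<lambda>t. h t * u t + Q t * v t)) has_real_derivative
             h x * u x + Q x * v x) (at x within {0..pi})"
      by (intro integral_has_real_derivative continuous_intros h cu cQ cv x)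
    then have "((\<lambda>x. v 0 - integral {0..x} (\<lambda>t. h t * u t + Q t * v t)) has_real_derivative
             - (h x * u x + Q x * v x)) (at x within {0..pi})"
      by (auto intro!: derivative_eq_intros)
    then have "(z has_real_derivative - (h x * u x + Q x * v x)) (at x within {0..pi})"
      by (rule has_field_derivative_transform_within[OF _ zero_less_one x]) (simp add: z)
    then show "(z has_real_derivative - (h x + (Q x)\<^sup>2) * u x - Q x * z x) (at x within {0..pi})"
      by (rule DERIV_cong) (simp add: z_def algebra_simps power2_eq_square)
  qed
  moreover have "quasi_bc \<alpha> Q u z"
    using vw(2) by (simp add: quasi_bc_def separated_bc_def z_def)
  ultimately show ?thesis by blast
qed

text \<open>
  The converse, with \<open>w = (q - h) u\<close> as the second derivative.
\<close>

lemma quasi_sol_imp_SL_operator: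
  assumes q: "q \<in> L2_0pi" and h: "continuous_on {0..pi} h"
  defines "Q \<equiv> \<lambda>x. integral {0..x} q"
  assumes sol: "quasi_sol Q h u z" and bc: "quasi_bc \<alpha> Q u z"
  shows "SL_operator \<alpha> q u (\<lambda>x. h x * u x)"
proof -
  define v where "v x = z x + Q x * u x" for x
  define w where "w x = (q x - h x) * u x" for x
  note cu = quasi_sol_continuous(1)[OF sol] and cz = quasi_sol_continuous(2)[OF sol]
  have du: "(u has_real_derivative v x) (at x within {0..pi})" if "x \<in> {0..pi}" for x
    using quasi_solD(1)[OF sol that] by (simp add: v_def)
  have aq: "q absolutely_integrable_on {0..pi}" by (rule L2_0pi_absolutely_integrable[OF q])
  have cQ: "continuous_on {0..pi} Q"
    unfolding Q_def by (rule L2_0pi_primitive_continuous[OF q])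
  have cv: "continuous_on {0..pi} v" unfolding v_def by (intro continuous_intros cz cQ cu)
  have "bounded (h ` {0..pi})" "bounded (u ` {0..pi})"
    by (intro compact_imp_bounded compact_continuous_image h cu compact_Icc)+
  then obtain H U where HU: "\<And>x. x \<in> {0..pi} \<Longrightarrow> \<bar>h x\<bar> \<le> H" "\<And>x. x \<in> {0..pi} \<Longrightarrow> \<bar>u x\<bar> \<le> U"
    unfolding bounded_iff by (metis image_eqI real_norm_def)
  have wL2: "w \<in> L2_0pi"
  proof -
    let ?M = "lebesgue_on {0<..<pi::real}"
    have qm: "q \<in> borel_measurable ?M" "integrable ?M (\<lambda>x. (q x)\<^sup>2)"
      using q by (auto simp: L2_0pi_def)
    have hm: "h \<in> borel_measurable ?M" "u \<in> borel_measurable ?M"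
      by (intro continuous_imp_measurable_on_sets_lebesgue continuous_on_subset[OF h]
          continuous_on_subset[OF cu]; auto)+
    have wm: "w \<in> borel_measurable ?M"
      unfolding w_def using qm hm by (intro borel_measurable_times borel_measurable_diff)
    have "finite_measure ?M" by (intro finite_measure_lebesgue_on) auto
    then have "integrable ?M (\<lambda>x. 2 * U\<^sup>2 * ((q x)\<^sup>2 + H\<^sup>2))"
      using qm by (intro integrable_mult_right Bochner_Integration.integrable_add
          finite_measure.integrable_const)
    then have "integrable ?M (\<lambda>x. (w x)\<^sup>2)"
    proof (rule Bochner_Integration.integrable_bound)
      show "AE x in ?M. norm ((w x)\<^sup>2) \<le> norm (2 * U\<^sup>2 * ((q x)\<^sup>2 + H\<^sup>2))"
      proof (rule AE_I2)
        fix x assume "x \<in> space ?M"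
        then have x: "x \<in> {0..pi}" by simp
        have "(q x - h x)\<^sup>2 + (q x + h x)\<^sup>2 = 2 * ((q x)\<^sup>2 + (h x)\<^sup>2)"
          by (simp add: power2_diff power2_sum)
        then have "(q x - h x)\<^sup>2 \<le> 2 * ((q x)\<^sup>2 + (h x)\<^sup>2)"
          using zero_le_power2[of "q x + h x"] by linarith
        also have "\<dots> \<le> 2 * ((q x)\<^sup>2 + H\<^sup>2)" using abs_le_square_iff[of "h x" H] HU(1)[OF x] by simp
        finally have "(q x - h x)\<^sup>2 * (u x)\<^sup>2 \<le> 2 * ((q x)\<^sup>2 + H\<^sup>2) * U\<^sup>2"
          using abs_le_square_iff[of "u x" U] HU(2)[OF x] by (intro mult_mono) auto
        then show "norm ((w x)\<^sup>2) \<le> norm (2 * U\<^sup>2 * ((q x)\<^sup>2 + H\<^sup>2))"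
          by (simp add: w_def power_mult_distrib distrib_left mult_ac)
      qed
    qed (use wm in simp)
    then show ?thesis using wm by (simp add: L2_0pi_def)
  qed
  have v_eq: "v x = v 0 + (LINT t:{0<..<x}|lebesgue. w t)" if x: "x \<in> {0..pi}" for x
  proof -
    have sub: "{0..x} \<subseteq> {0..pi}" using x by auto
    have 1: "Q x * u x = integral {0..x} (\<lambda>t. u t * q t) + integral {0..x} (\<lambda>t. Q t * v t)"
      unfolding Q_def by (rule integral_by_parts_primitive_upto[OF aq du cv x])
    have iuq: "(\<lambda>t. u t * q t) integrable_on {0..x}"
      using absolutely_integrable_on_subinterval[OF abs_integrable_mult_continuous[OF aq cu] sub]
      by (simp add: absolutely_integrable_on_def)
    have ihu: "(\<lambda>t. h t * u t) integrable_on {0..x}"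
      by (intro integrable_continuous_real continuous_intros continuous_on_subset[OF h sub]
          continuous_on_subset[OF cu sub])
    have iQv: "(\<lambda>t. Q t * v t) integrable_on {0..x}"
      by (intro integrable_continuous_real continuous_intros continuous_on_subset[OF cQ sub]
          continuous_on_subset[OF cv sub])
    have "((\<lambda>t. - (h t * u t + Q t * v t)) has_integral z x - z 0) {0..x}"
    proof (rule fundamental_theorem_of_calculus)
      fix t assume t: "t \<in> {0..x}"
      then have "(z has_real_derivative - (h t + (Q t)\<^sup>2) * u t - Q t * z t) (at t within {0..x})"
        using DERIV_subset[OF quasi_solD(2)[OF sol] sub] sub by blast
      then have "(z has_real_derivative - (h t * u t + Q t * v t)) (at t within {0..x})"
        by (rule DERIV_cong) (simp add: v_def algebra_simps power2_eq_square)
      then show "(z has_vector_derivative - (h t * u t + Q t * v t)) (at t within {0..x})"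
        by (simp add: has_real_derivative_iff_has_vector_derivative)
    qed (use x in auto)
    then have "z x - z 0 = - (integral {0..x} (\<lambda>t. h t * u t) + integral {0..x} (\<lambda>t. Q t * v t))"
      using Henstock_Kurzweil_Integration.integral_add[OF ihu iQv]
      by (metis integral_neg integral_unique)
    moreover have "integral {0..x} w = integral {0..x} (\<lambda>t. u t * q t) - integral {0..x} (\<lambda>t. h t * u t)"
      using Henstock_Kurzweil_Integration.integral_diff[OF iuq ihu]
      by (simp add: w_def[abs_def] algebra_simps)
    moreover have "Q 0 = 0" by (simp add: Q_def)
    moreover have "(LINT t:{0<..<x}|lebesgue. w t) = integral {0..x} w"
      by (rule set_lebesgue_integral_eq_integral_Icc[OF L2_0pi_absolutely_integrable[OF wL2] x])
    ultimately show ?thesis using 1 by (simp add: v_def)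
  qed
  have "W22_0pi u v w" unfolding W22_0pi_def using du wL2 v_eq by blast
  moreover have "separated_bc \<alpha> u v" using bc by (simp add: quasi_bc_def v_def[abs_def])
  moreover have "AE x in lebesgue_on {0<..<pi}. - w x + q x * u x = h x * u x"
    by (simp add: w_def algebra_simps)
  ultimately show ?thesis unfolding SL_operator_def by blast
qed

section \<open>A scalar differential equation with a parameter\<close>

text \<open>
  Joint continuity of \<open>(x, l) \<mapsto> integral {0..c x} (\<lambda>t. g (t, l))\<close>, obtained by rescaling to the fixed interval \<open>[0, 1]\<close>.
\<close>

lemma continuous_parametric_primitive:
  fixes g :: "real \<times> 'a::topological_space \<Rightarrow> real" and c :: "real \<Rightarrow> real"
  assumes g: "continuous_on UNIV g" and c: "continuous_on UNIV c" and c0: "\<And>x. c x \<ge> 0"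
  shows "continuous_on UNIV (\<lambda>p. integral {0..c (fst p)} (\<lambda>t. g (t, snd p)))"
proof -
  have eq: "integral {0..X} (\<lambda>t. g (t, l)) = integral {0..1} (\<lambda>s. X * g (X * s, l))"
    if "X \<ge> 0" for X l
  proof -
    have "((\<lambda>s. X *\<^sub>R g (X * s, l)) has_integral (integral {X * 0..X * 1} (\<lambda>t. g (t, l)))) {0..1}"
    proof (rule has_integral_substitution[where c = 0 and d = X])
      show "(*) X ` {0..1} \<subseteq> {0..X}" using that by (auto simp: mult_left_le)
      show "continuous_on {0..X} (\<lambda>t. g (t, l))"
        by (intro continuous_on_compose2[OF g] continuous_intros) auto
    qed (use that in \<open>auto intro!: derivative_eq_intros\<close>)
    then show ?thesis by (simp add: integral_unique flip: integral_mult_right)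
  qed
  have "continuous_on UNIV (\<lambda>p. integral (cbox 0 1) (\<lambda>s. c (fst p) * g (c (fst p) * s, snd p)))"
  proof (rule integral_continuous_on_param)
    have c': "continuous_on T (\<lambda>x. c (h x))" if "continuous_on T h"
      for T and h :: "(real \<times> 'a) \<times> real \<Rightarrow> real"
      using continuous_on_compose2[OF c that] by simp
    have g': "continuous_on T (\<lambda>x. g (h x))" if "continuous_on T h"
      for T and h :: "(real \<times> 'a) \<times> real \<Rightarrow> real \<times> 'a"
      using continuous_on_compose2[OF g that] by simp
    show "continuous_on (UNIV \<times> cbox 0 1) (\<lambda>(p, s). c (fst p) * g (c (fst p) * s, snd p))"
      unfolding split_beta by (intro continuous_intros c' g')
  qed
  then show ?thesis by (simp add: eq c0)
qed

text \<open>
  Global existence for a scalar equation \<open>\<theta>' = f t l \<theta>\<close> with a parameter \<open>l\<close>. The Picard operator acts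
  on functions of the pair \<open>(t, l)\<close>, so its fixed point is automatically jointly continuous, and no
  separate argument for the continuous dependence on \<open>l\<close> is needed.
\<close>

lemma parametric_ode_solution:
  fixes f :: "real \<Rightarrow> 'a::metric_space \<Rightarrow> real \<Rightarrow> real"
  assumes cont: "continuous_on UNIV (\<lambda>(t, l, y). f t l y)"
    and lip: "\<And>t l y y'. \<bar>f t l y - f t l y'\<bar> \<le> L * \<bar>y - y'\<bar>"
    and bnd: "\<And>t l y. \<bar>f t l y\<bar> \<le> M"
    and L: "L > 0" and b: "b > 0"
  obtains \<theta> :: "real \<Rightarrow> 'a \<Rightarrow> real"
  where "continuous_on UNIV (\<lambda>(t, l). \<theta> t l)" "\<And>l. \<theta> 0 l = \<beta>"
    "\<And>l t. t \<in> {0..b} \<Longrightarrow> ((\<lambda>t. \<theta> t l) has_real_derivative f t l (\<theta> t l)) (at t within {0..b})"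
proof -
  define c where "c x = max 0 (min b x)" for x :: real
  have c: "0 \<le> c x" "c x \<le> b" for x using b by (auto simp: c_def)
  have cid: "c x = x" if "x \<in> {0..b}" for x using that by (auto simp: c_def)
  have cc: "continuous_on UNIV c" unfolding c_def by (intro continuous_intros)
  define G where "G y p = f (fst p) (snd p) (exp (2 * L * fst p) * y p)"
    for y :: "(real \<times> 'a) \<Rightarrow>\<^sub>C real" and p
  have contf: "continuous_on T (\<lambda>x. f (h1 x) (h2 x) (h3 x))"
    if "continuous_on T h1" "continuous_on T h2" "continuous_on T h3"
    for T and h1 h3 :: "real \<times> 'a \<Rightarrow> real" and h2
    using continuous_on_compose2[OF cont, of T "\<lambda>x. (h1 x, h2 x, h3 x)"] that
    by (simp add: continuous_on_Pair)
  have contG: "continuous_on UNIV (G y)" for y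
    unfolding G_def by (intro contf continuous_intros continuous_on_apply_bcontfun)
  have contG1: "continuous_on T (\<lambda>t. G y (t, l))" for y T l
    by (intro continuous_on_compose2[OF contG] continuous_intros) auto
  define I where "I y p = integral {0..c (fst p)} (\<lambda>t. G y (t, snd p))" for y p
  \<comment> \<open>With the weight \<open>exp (- 2 L t)\<close> the Picard operator contracts by \<open>1 / 2\<close> on the whole interval.\<close>
  define S where "S y p = exp (- 2 * L * c (fst p)) * (\<beta> + I y p)" for y p
  have "S y \<in> bcontfun" for y
    unfolding bcontfun_def mem_Collect_eq
  proof
    have "continuous_on UNIV (\<lambda>p::real \<times> 'a. c (fst p))"
      by (intro continuous_on_compose2[OF cc] continuous_intros) auto
    then show "continuous_on UNIV (S y)"
      unfolding S_def I_def
      by (intro continuous_intros continuous_parametric_primitive[OF contG cc c(1)])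
    have "norm (S y p) \<le> \<bar>\<beta>\<bar> + M * b" for p
    proof -
      have M: "M \<ge> 0" using bnd[of undefined undefined undefined] by linarith
      have "norm (I y p) \<le> M * (c (fst p) - 0)"
        unfolding I_def by (intro integral_bound contG1) (use c bnd in \<open>auto simp: G_def\<close>)
      also have "\<dots> \<le> M * b" using c M by (intro mult_left_mono) auto
      finally have "\<bar>\<beta> + I y p\<bar> \<le> \<bar>\<beta>\<bar> + M * b" by simp
      moreover have "exp (- 2 * L * c (fst p)) \<le> 1" using c L by simp
      ultimately have "exp (- 2 * L * c (fst p)) * \<bar>\<beta> + I y p\<bar> \<le> 1 * (\<bar>\<beta>\<bar> + M * b)"
        by (intro mult_mono) auto
      then show ?thesis by (simp add: S_def abs_mult)
    qed
    then show "bounded (range (S y))" unfolding bounded_iff by blast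
  qed
  then have S: "apply_bcontfun (Bcontfun (S y)) = S y" for y by (simp add: Bcontfun_inverse)
  have "dist (Bcontfun (S y)) (Bcontfun (S y')) \<le> 1 / 2 * dist y y'" for y y'
  proof (rule dist_bound, unfold S)
    fix p :: "real \<times> 'a"
    define X where "X = c (fst p)"
    define d where "d = dist y y'"
    have X: "X \<ge> 0" using c by (simp add: X_def)
    have H: "((\<lambda>t. L * (exp (2 * L * t) * d)) has_integral
               (d / 2 * exp (2 * L * X) - d / 2 * exp (2 * L * 0))) {0..X}"
      by (rule fundamental_theorem_of_calculus[OF X])
        (auto intro!: derivative_eq_intros simp: has_real_derivative_iff_has_vector_derivative[symmetric])
    have "I y p - I y' p = integral {0..X} (\<lambda>t. G y (t, snd p) - G y' (t, snd p))"
      unfolding I_def X_def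
      by (subst Henstock_Kurzweil_Integration.integral_diff)
        (auto intro!: integrable_continuous_real contG1)
    also have "norm \<dots> \<le> integral {0..X} (\<lambda>t. L * (exp (2 * L * t) * d))"
    proof (rule integral_norm_bound_integral)
      show "(\<lambda>t. G y (t, snd p) - G y' (t, snd p)) integrable_on {0..X}"
        by (intro integrable_continuous_real continuous_intros contG1)
      show "(\<lambda>t. L * (exp (2 * L * t) * d)) integrable_on {0..X}" using H by blast
      fix t
      have "norm (G y (t, snd p) - G y' (t, snd p))
              \<le> L * \<bar>exp (2 * L * t) * y (t, snd p) - exp (2 * L * t) * y' (t, snd p)\<bar>"
        unfolding G_def real_norm_def fst_conv snd_conv by (rule lip)
      also have "\<dots> = L * (exp (2 * L * t) * dist (y (t, snd p)) (y' (t, snd p)))"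
        by (simp add: dist_real_def abs_mult flip: right_diff_distrib)
      also have "\<dots> \<le> L * (exp (2 * L * t) * d)"
        unfolding d_def using L by (intro mult_left_mono dist_bounded) auto
      finally show "norm (G y (t, snd p) - G y' (t, snd p)) \<le> L * (exp (2 * L * t) * d)" .
    qed
    also have "\<dots> = d / 2 * exp (2 * L * X) - d / 2"
      unfolding integral_unique[OF H] by simp
    finally have "\<bar>I y p - I y' p\<bar> \<le> d / 2 * exp (2 * L * X)"
      using zero_le_dist[of y y'] unfolding d_def real_norm_def by linarith
    have "dist (S y p) (S y' p) = exp (- (2 * L * X)) * \<bar>I y p - I y' p\<bar>"
      by (simp add: S_def X_def dist_real_def abs_mult flip: right_diff_distrib)
    also have "\<dots> \<le> exp (- (2 * L * X)) * (d / 2 * exp (2 * L * X))"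
      by (intro mult_left_mono \<open>\<bar>I y p - I y' p\<bar> \<le> d / 2 * exp (2 * L * X)\<close>) simp
    also have "\<dots> = d / 2" by (simp add: exp_minus field_simps)
    finally show "dist (S y p) (S y' p) \<le> 1 / 2 * dist y y'" by (simp add: d_def)
  qed
  then obtain y where y: "Bcontfun (S y) = y"
    using banach_fix_type[of "1/2" "\<lambda>y. Bcontfun (S y)"] by auto
  then have yS: "apply_bcontfun y = S y" using S[of y] by simp
  define \<theta> where "\<theta> t l = \<beta> + I y (t, l)" for t l
  have \<theta>y: "\<theta> t l = exp (2 * L * c t) * y (t, l)" for t l
    unfolding yS \<theta>_def S_def by (simp add: exp_minus)
  show ?thesis
  proof (rule that[of \<theta>])
    have "continuous_on UNIV (I y)"
      unfolding I_def by (intro continuous_parametric_primitive[OF contG cc c(1)])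
    then show "continuous_on UNIV (\<lambda>(t, l). \<theta> t l)"
      unfolding \<theta>_def split_beta by (simp add: continuous_on_add)
    show "\<theta> 0 l = \<beta>" for l using b by (simp add: \<theta>_def I_def c_def)
    fix l t assume t: "t \<in> {0..b}"
    have "((\<lambda>x. integral {0..x} (\<lambda>t. G y (t, l))) has_real_derivative G y (t, l)) (at t within {0..b})"
      by (intro integral_has_real_derivative contG1 t)
    then have "((\<lambda>x. \<beta> + integral {0..x} (\<lambda>t. G y (t, l))) has_real_derivative G y (t, l))
                 (at t within {0..b})"
      by (auto intro!: derivative_eq_intros)
    then have "((\<lambda>t. \<theta> t l) has_real_derivative G y (t, l)) (at t within {0..b})"
      by (rule has_field_derivative_transform_within[OF _ zero_less_one t]) (simp add: \<theta>_def I_def cid)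
    then show "((\<lambda>t. \<theta> t l) has_real_derivative f t l (\<theta> t l)) (at t within {0..b})"
      by (simp add: G_def \<theta>y cid[OF t])
  qed
qed

section \<open>The phase of a solution\<close>

text \<open>
  A function that can cross zero only upwards stays positive once it is nonnegative.
\<close>

lemma stays_positive:
  fixes g :: "real \<Rightarrow> real"
  assumes g: "continuous_on {a..b} g"
    and d: "\<And>x. x \<in> {a..b} \<Longrightarrow> g x = 0 \<Longrightarrow> \<exists>d>0. (g has_real_derivative d) (at x within {a..b})"
    and a: "g a \<ge> 0" and y: "a < y" "y \<le> b"
  shows "g y > 0"
proof (rule ccontr)
  assume neg: "\<not> g y > 0"
  obtain a1 where a1: "a \<le> a1" "a1 < y" "g a1 > 0"
  proof (cases "g a = 0")
    case True
    then obtain k where k: "k > 0" "(g has_real_derivative k) (at a within {a..b})" using d[of a] y by auto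
    then obtain e where e: "e > 0" "\<And>h. h > 0 \<Longrightarrow> a + h \<in> {a..b} \<Longrightarrow> h < e \<Longrightarrow> g a < g (a + h)"
      using has_real_derivative_pos_inc_right[OF k(2,1)] by blast
    define h where "h = min e (y - a) / 2"
    have "h > 0" "h < e" "a + h < y" using e(1) y by (auto simp: h_def min_def field_simps)
    then show ?thesis using that[of "a + h"] e(2)[of h] True y by auto
  qed (use that[of a] a y in auto)
  define c where "c = Inf {x \<in> {a1..y}. g x \<le> 0}"
  have cl: "closed {x \<in> {a1..y}. g x \<le> 0}"
  proof -
    have "continuous_on {a1..y} g" by (rule continuous_on_subset[OF g]) (use a1 y in auto)
    then have "closed ({a1..y} \<inter> g -` {..0})" by (intro continuous_closed_preimage) auto
    moreover have "{a1..y} \<inter> g -` {..0} = {x \<in> {a1..y}. g x \<le> 0}" by auto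
    ultimately show ?thesis by simp
  qed
  have ne: "{x \<in> {a1..y}. g x \<le> 0} \<noteq> {}" using neg a1 by auto
  have bb: "bdd_below {x \<in> {a1..y}. g x \<le> 0}" by (rule bdd_belowI[of _ a1]) auto
  have c: "c \<in> {a1..y}" "g c \<le> 0" using closed_contains_Inf[OF ne bb cl] by (auto simp: c_def)
  have "a1 < c" using c a1 by (cases "c = a1") auto
  have pos: "g x > 0" if "a1 \<le> x" "x < c" for x
    using cInf_lower[OF _ bb, of x] that c unfolding c_def[symmetric] by (auto simp: not_le[symmetric])
  have "g c \<ge> 0"
    by (rule nonneg_at_ends[of a1 c g]) (use continuous_on_subset[OF g] pos \<open>a1 < c\<close> c a1 y in auto)
  then have "g c = 0" using c by simp
  then obtain k where k: "k > 0" "(g has_real_derivative k) (at c within {a..b})"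
    using d[of c] c a1 y by auto
  then obtain e where e: "e > 0" "\<And>h. h > 0 \<Longrightarrow> c - h \<in> {a..b} \<Longrightarrow> h < e \<Longrightarrow> g (c - h) < g c"
    using has_real_derivative_pos_inc_left[OF k(2,1)] by blast
  define h where "h = min e (c - a1) / 2"
  have "h > 0" "h < e" "a1 < c - h" using e(1) \<open>a1 < c\<close> by (auto simp: h_def min_def field_simps)
  then show False using e(2)[of h] pos[of "c - h"] \<open>g c = 0\<close> c a1 y by auto
qed

text \<open>
  The phase crosses each multiple of \<open>pi\<close> at most once, and upwards. Between a starting value in
  \<open>[0, pi)\<close> and a final value in \<open>(n pi, (n + 1) pi]\<close> it therefore meets exactly \<open>pi, \<dots>, n pi\<close> in the
  open interval. The half-open ranges are such that a Dirichlet condition at an end point does not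
  count as a root.
\<close>

lemma phase_zero_count:
  fixes \<theta> :: "real \<Rightarrow> real" and n :: nat
  assumes c: "continuous_on {0..pi} \<theta>"
    and d: "\<And>x. x \<in> {0..pi} \<Longrightarrow> sin (\<theta> x) = 0 \<Longrightarrow>
              \<exists>d>0. (\<theta> has_real_derivative d) (at x within {0..pi})"
    and start: "0 \<le> \<theta> 0" "\<theta> 0 < pi"
    and fin: "\<theta> pi = \<gamma> + real n * pi" "0 < \<gamma>" "\<gamma> \<le> pi"
  shows "finite {x \<in> {0<..<pi}. sin (\<theta> x) = 0}" "card {x \<in> {0<..<pi}. sin (\<theta> x) = 0} = n"
proof -
  let ?Z = "{x \<in> {0<..<pi}. sin (\<theta> x) = 0}"
  have up: "\<theta> y > of_int m * pi" if "0 \<le> x" "x < y" "y \<le> pi" "\<theta> x \<ge> of_int m * pi" for x y m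
  proof -
    have sub: "{x..pi} \<subseteq> {0..pi}" using that by auto
    have "\<theta> y - of_int m * pi > 0"
    proof (rule stays_positive[of x pi "\<lambda>x. \<theta> x - of_int m * pi"])
      show "continuous_on {x..pi} (\<lambda>x. \<theta> x - of_int m * pi)"
        by (intro continuous_intros continuous_on_subset[OF c sub])
      fix t assume t: "t \<in> {x..pi}" "\<theta> t - of_int m * pi = 0"
      then have "sin (\<theta> t) = 0" by (simp add: sin_zero_iff_int2)
      then obtain k where "k > 0" "(\<theta> has_real_derivative k) (at t within {0..pi})"
        using d[of t] t sub by auto
      then show "\<exists>d>0. ((\<lambda>x. \<theta> x - of_int m * pi) has_real_derivative d) (at t within {x..pi})"
        by (intro exI[of _ k]) (auto intro!: derivative_eq_intros DERIV_subset[OF _ sub])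
    qed (use that in auto)
    then show ?thesis by simp
  qed
  have inj: "inj_on \<theta> ?Z"
  proof (rule linorder_inj_onI)
    fix x y assume xy: "x < y" "x \<in> ?Z" "y \<in> ?Z"
    then obtain m :: int where "\<theta> x = of_int m * pi" by (auto simp: sin_zero_iff_int2)
    then show "\<theta> x \<noteq> \<theta> y" using up[of x y m] xy by auto
  qed auto
  have img: "\<theta> ` ?Z = (\<lambda>m. real m * pi) ` {1..n}"
  proof (intro equalityI subsetI)
    fix t assume "t \<in> \<theta> ` ?Z"
    then obtain x where x: "0 < x" "x < pi" "sin (\<theta> x) = 0" "t = \<theta> x" by auto
    then obtain m :: int where m: "\<theta> x = of_int m * pi" by (auto simp: sin_zero_iff_int2)
    have "m \<ge> 1"
    proof (rule ccontr)
      assume "\<not> m \<ge> 1"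
      then have "of_int m * pi \<le> 0" by (simp add: mult_le_0_iff)
      then show False using up[of 0 x m] start x m by simp
    qed
    have "of_int m * pi < \<gamma> + real n * pi" using up[of x pi m] x m fin by simp
    also have "\<dots> \<le> (1 + real n) * pi" using fin by (simp add: algebra_simps)
    finally have "of_int m < 1 + real n" by simp
    then have "t = real (nat m) * pi" "nat m \<in> {1..n}" using \<open>m \<ge> 1\<close> x m by auto
    then show "t \<in> (\<lambda>m. real m * pi) ` {1..n}" by blast
  next
    fix t assume "t \<in> (\<lambda>m. real m * pi) ` {1..n}"
    then obtain m where m: "m \<in> {1..n}" "t = real m * pi" by auto
    have "1 * pi \<le> real m * pi" "real m * pi \<le> real n * pi" using m by (auto intro: mult_right_mono)
    then have lt: "\<theta> 0 < t" "t < \<theta> pi" unfolding m(2) using start fin by linarith+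
    then obtain x where x: "0 \<le> x" "x \<le> pi" "\<theta> x = t"
      using IVT'[of \<theta> 0 t pi] c by (auto intro: less_imp_le)
    then have "x \<noteq> 0" "x \<noteq> pi" using lt by auto
    moreover have "sin t = 0" unfolding m by (simp add: sin_npi)
    ultimately have "x \<in> ?Z" using x by auto
    then show "t \<in> \<theta> ` ?Z" using x by blast
  qed
  show "finite ?Z" using inj img by (metis finite_atLeastAtMost finite_imageI finite_image_iff)
  have "card ?Z = card ((\<lambda>m. real m * pi) ` {1..n})" using card_image[OF inj] img by simp
  also have "\<dots> = n" by (subst card_image) (auto intro: inj_onI)
  finally show "card ?Z = n" .
qed

text \<open>
  A boundary condition fixes the phase modulo \<open>pi\<close>; the representative can be taken in \<open>[0, pi)\<close> or in
  \<open>(0, pi]\<close>.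
\<close>

lemma ex_angle:
  fixes A B :: real
  shows "\<exists>\<beta>. 0 \<le> \<beta> \<and> \<beta> < pi \<and> A * sin \<beta> + B * cos \<beta> = 0"
    and "\<exists>\<gamma>. 0 < \<gamma> \<and> \<gamma> \<le> pi \<and> A * sin \<gamma> + B * cos \<gamma> = 0"
proof -
  define f where "f t = A * sin t + B * cos t" for t
  have c: "continuous_on {0..pi} f" unfolding f_def by (intro continuous_intros)
  have f: "f 0 = B" "f pi = - B" by (simp_all add: f_def)
  have "\<exists>t. 0 \<le> t \<and> t \<le> pi \<and> f t = 0"
    using IVT'[of f 0 0 pi] IVT2'[of f pi 0 0] c f by (cases "B \<le> 0") auto
  then obtain t where t: "0 \<le> t" "t \<le> pi" "f t = 0" by blast
  show "\<exists>\<beta>. 0 \<le> \<beta> \<and> \<beta> < pi \<and> A * sin \<beta> + B * cos \<beta> = 0"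
  proof (cases "t = pi")
    case True then show ?thesis using t f pi_gt_zero by (intro exI[of _ 0]) auto
  qed (use t in \<open>auto simp: f_def\<close>)
  show "\<exists>\<gamma>. 0 < \<gamma> \<and> \<gamma> \<le> pi \<and> A * sin \<gamma> + B * cos \<gamma> = 0"
  proof (cases "t = 0")
    case True then show ?thesis using t f pi_gt_zero by (intro exI[of _ pi]) auto
  qed (use t in \<open>auto simp: f_def intro!: exI[of _ t]\<close>)
qed

text \<open>
  Pruefer substitution \<open>u = r sin \<theta>\<close>, \<open>z = s r cos \<theta>\<close> with a scaling factor \<open>s > 0\<close>: a solution of the
  phase equation, completed by the amplitude \<open>r\<close> with \<open>r' = \<rho> r\<close>, gives a solution of the linear
  system.
\<close>

lemma phase_imp_quasi_sol:
  assumes Q: "continuous_on {0..pi} Q" and s: "s > 0"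
    and \<theta>: "\<And>x. x \<in> {0..pi} \<Longrightarrow> (\<theta> has_real_derivative
           ((s * cos (\<theta> x) + Q x * sin (\<theta> x))\<^sup>2 + l * (sin (\<theta> x))\<^sup>2) / s) (at x within {0..pi})"
  shows "\<exists>r. (\<forall>x. r x > 0) \<and>
           quasi_sol Q (\<lambda>_. l) (\<lambda>x. r x * sin (\<theta> x)) (\<lambda>x. s * r x * cos (\<theta> x))"
proof -
  have c\<theta>: "continuous_on {0..pi} \<theta>" using \<theta> by (rule DERIV_continuous_on)
  define \<rho> where "\<rho> x = sin (\<theta> x) * (Q x * sin (\<theta> x) + s * cos (\<theta> x))
      - cos (\<theta> x) * ((l + (Q x)\<^sup>2) * sin (\<theta> x) / s + Q x * cos (\<theta> x))" for x
  define r where "r x = exp (integral {0..x} \<rho>)" for x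
  have c\<rho>: "continuous_on {0..pi} \<rho>"
    unfolding \<rho>_def using s by (intro continuous_intros Q c\<theta>) auto
  have dr: "(r has_real_derivative r x * \<rho> x) (at x within {0..pi})" if "x \<in> {0..pi}" for x
    unfolding r_def
    by (rule derivative_eq_intros integral_has_real_derivative[OF c\<rho> that] refl)+
  have "quasi_sol Q (\<lambda>_. l) (\<lambda>x. r x * sin (\<theta> x)) (\<lambda>x. s * r x * cos (\<theta> x))"
    unfolding quasi_sol_def
  proof (intro ballI conjI)
    fix x assume x: "x \<in> {0..pi}"
    define S C where "S = sin (\<theta> x)" and "C = cos (\<theta> x)"
    have SC: "S\<^sup>2 + C\<^sup>2 = 1" by (simp add: S_def C_def)
    define T where "T = ((s * C + Q x * S)\<^sup>2 + l * S\<^sup>2) / s"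
    have d: "(\<theta> has_real_derivative T) (at x within {0..pi})"
      using \<theta>[OF x] by (simp add: T_def S_def C_def)
    have sT: "s * T = (s * C + Q x * S)\<^sup>2 + l * S\<^sup>2" using s by (simp add: T_def)
    have s\<rho>: "s * \<rho> x = s * S * (Q x * S + s * C) - C * ((l + (Q x)\<^sup>2) * S + s * Q x * C)"
      using s by (simp add: \<rho>_def S_def C_def field_simps)
    have 1: "\<rho> x * S + C * T = s * C + Q x * S"
    proof -
      have "s * (\<rho> x * S + C * T) = s * (s * C + Q x * S)"
        using s\<rho> sT SC by algebra
      then show ?thesis using s by simp
    qed
    have 2: "s * \<rho> x * C - s * S * T = - (l + (Q x)\<^sup>2) * S - Q x * s * C"
      using s\<rho> sT SC by algebra
    show "((\<lambda>x. r x * sin (\<theta> x)) has_real_derivative s * r x * cos (\<theta> x) + Q x * (r x * sin (\<theta> x)))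
            (at x within {0..pi})"
    proof -
      have "((\<lambda>x. r x * sin (\<theta> x)) has_real_derivative r x * (\<rho> x * S + C * T)) (at x within {0..pi})"
        by (rule derivative_eq_intros dr[OF x] d refl)+ (simp add: S_def C_def algebra_simps)
      then show ?thesis unfolding 1 by (rule DERIV_cong) (simp add: S_def C_def algebra_simps)
    qed
    show "((\<lambda>x. s * r x * cos (\<theta> x)) has_real_derivative
        - (l + (Q x)\<^sup>2) * (r x * sin (\<theta> x)) - Q x * (s * r x * cos (\<theta> x))) (at x within {0..pi})"
    proof -
      have "((\<lambda>x. s * r x * cos (\<theta> x)) has_real_derivative r x * (s * \<rho> x * C - s * S * T))
              (at x within {0..pi})"
        by (rule derivative_eq_intros dr[OF x] d refl)+ (simp add: S_def C_def algebra_simps)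
      then show ?thesis unfolding 2 by (rule DERIV_cong) (simp add: S_def C_def algebra_simps)
    qed
  qed
  then show ?thesis by (intro exI[of _ r]) (simp add: r_def)
qed

section \<open>Existence of eigenfunctions with a given number of roots\<close>

text \<open>
  Shooting. The initial phase is \<open>\<beta> \<in> [0, pi)\<close>, and an eigenfunction with \<open>n\<close> roots appears when the
  final phase, which is continuous in \<open>l\<close>, equals \<open>\<gamma> + n pi\<close> with \<open>\<gamma> \<in> (0, pi]\<close>. The intermediate
  value theorem applies between two values of \<open>l\<close>. For \<open>l = lo\<close>, very negative, the phase
  stays below a straight line \<open>\<eta>\<close> from above \<open>\<beta>\<close> to \<open>\<gamma> / 2\<close>. For \<open>l = hi\<close>, the phase has slope at least
  \<open>s / 2 = n + 1\<close>.
\<close>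

lemma eigenfunction_with_roots:
  assumes Q: "continuous_on {0..pi} Q"
  shows "\<exists>l u z. quasi_sol Q (\<lambda>_. l) u z \<and> quasi_bc \<alpha> Q u z \<and> nonzero_0pi u \<and>
           finite (roots_0pi u) \<and> card (roots_0pi u) = n"
proof -
  \<comment> \<open>The scaling makes the slope \<open>s / 2\<close> large enough to reach the target phase when \<open>l = hi\<close>.\<close>
  define s :: real where "s = 2 * (real n + 1)"
  have s: "s > 0" by (simp add: s_def)
  have "bounded (Q ` {0..pi})" by (intro compact_imp_bounded compact_continuous_image Q compact_Icc)
  then obtain K where K: "\<And>x. x \<in> {0..pi} \<Longrightarrow> \<bar>Q x\<bar> \<le> K"
    unfolding bounded_iff by (metis image_eqI real_norm_def)
  have K0: "K \<ge> 0" using K[of 0] by (simp add: order_trans[OF abs_ge_zero])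
  obtain \<beta> where \<beta>: "0 \<le> \<beta>" "\<beta> < pi"
    "(cos \<alpha> + Q 0 * sin \<alpha>) * sin \<beta> + (s * sin \<alpha>) * cos \<beta> = 0" using ex_angle(1) by blast
  obtain \<gamma> where \<gamma>: "0 < \<gamma>" "\<gamma> \<le> pi"
    "(cos \<alpha> + Q pi * sin \<alpha>) * sin \<gamma> + (s * sin \<alpha>) * cos \<gamma> = 0" using ex_angle(2) by blast
  define p m where "p = (\<beta> + pi) / 2" and "m = (\<gamma> / 2 - p) / pi"
  define \<eta> where "\<eta> x = p + m * x" for x
  have \<eta>: "0 < \<eta> x \<and> \<eta> x < pi" if "x \<in> {0..pi}" for x
  proof -
    define t where "t = x / pi"
    have t: "0 \<le> t" "t \<le> 1" using that by (auto simp: t_def)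
    have pg: "0 < p" "p < pi" "0 < \<gamma> / 2" "\<gamma> / 2 < pi" using \<beta> \<gamma> by (auto simp: p_def)
    have "\<eta> x = (1 - t) * p + t * (\<gamma> / 2)" by (simp add: \<eta>_def m_def t_def field_simps)
    then show ?thesis
      using convex_bound_lt[of p pi "\<gamma> / 2" "1 - t" t] convex_bound_lt[of "-p" 0 "-\<gamma> / 2" "1 - t" t] t pg
      by simp
  qed
  obtain s0 where s0: "s0 > 0" "\<And>x. x \<in> {0..pi} \<Longrightarrow> s0 \<le> sin (\<eta> x)"
  proof -
    have "continuous_on {0..pi} (\<lambda>x. sin (\<eta> x))" unfolding \<eta>_def by (intro continuous_intros)
    then obtain x0 where "x0 \<in> {0..pi}" "\<And>x. x \<in> {0..pi} \<Longrightarrow> sin (\<eta> x0) \<le> sin (\<eta> x)"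
      using continuous_attains_inf[of "{0..pi}" "\<lambda>x. sin (\<eta> x)"] by auto
    then show ?thesis using that[of "sin (\<eta> x0)"] \<eta> sin_gt_zero by blast
  qed
  define lo hi where "lo = - (((s + K)\<^sup>2 + s * \<bar>m\<bar> + 1) / s0\<^sup>2)" and "hi = s\<^sup>2 / 2 + K\<^sup>2"
  have lohi: "lo < 0" "0 \<le> hi" using s s0(1) K0
    by (auto simp: lo_def hi_def intro!: divide_pos_pos add_nonneg_pos add_nonneg_nonneg)
  \<comment> \<open>Clamping both variables makes the right-hand side globally continuous, bounded and Lipschitz.\<close>
  define Qe where "Qe x = Q (max 0 (min pi x))" for x
  define le where "le l = max lo (min hi l)" for l
  have Qe: "Qe x = Q x" if "x \<in> {0..pi}" for x using that by (auto simp: Qe_def)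
  have QeK: "\<bar>Qe x\<bar> \<le> K" for x unfolding Qe_def by (rule K) auto
  have le: "le l = l" if "l \<in> {lo..hi}" for l using that by (auto simp: le_def)
  define \<Lambda> where "\<Lambda> = \<bar>lo\<bar> + \<bar>hi\<bar>"
  have le\<Lambda>: "\<bar>le l\<bar> \<le> \<Lambda>" for l unfolding le_def \<Lambda>_def by (auto simp: max_def min_def)
  have \<Lambda>0: "\<Lambda> \<ge> 0" by (simp add: \<Lambda>_def)
  define f where "f x l y = ((s * cos y + Qe x * sin y)\<^sup>2 + le l * (sin y)\<^sup>2) / s" for x l y
  have sumK: "\<bar>s * a + Qe x * b\<bar> \<le> s + K" if "\<bar>a\<bar> \<le> 1" "\<bar>b\<bar> \<le> 1" for a b x
  proof -
    have "\<bar>s * a + Qe x * b\<bar> \<le> \<bar>s * a\<bar> + \<bar>Qe x * b\<bar>" by (rule abs_triangle_ineq)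
    also have "\<dots> \<le> s * 1 + K * 1" unfolding abs_mult
      using that s QeK[of x] K0 by (intro add_mono mult_mono) auto
    finally show ?thesis by simp
  qed
  obtain \<theta> where \<theta>: "continuous_on UNIV (\<lambda>(x, l). \<theta> x l)" "\<And>l. \<theta> 0 l = \<beta>"
    "\<And>l x. x \<in> {0..pi} \<Longrightarrow> ((\<lambda>x. \<theta> x l) has_real_derivative f x l (\<theta> x l)) (at x within {0..pi})"
  proof (rule parametric_ode_solution[of f "(2 * (s + K) * (s + K) + 2 * \<Lambda>) / s" "((s + K)\<^sup>2 + \<Lambda>) / s" pi \<beta>])
    have "continuous_on UNIV (Q \<circ> (\<lambda>x. max 0 (min pi x)))"
      by (intro continuous_on_compose continuous_intros continuous_on_subset[OF Q]) auto
    then have "continuous_on UNIV Qe" by (simp add: Qe_def o_def)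
    then have cQe: "continuous_on UNIV (\<lambda>x::real \<times> real \<times> real. Qe (fst x))"
      by (rule continuous_on_compose2) (auto intro: continuous_on_fst continuous_on_id)
    show "continuous_on UNIV (\<lambda>(t, l, y). f t l y)"
      unfolding f_def le_def split_beta using s by (intro continuous_intros cQe) auto
    show "\<bar>f x l y - f x l y'\<bar> \<le> (2 * (s + K) * (s + K) + 2 * \<Lambda>) / s * \<bar>y - y'\<bar>" for x l y y'
    proof -
      define df where "df y = (2 * (s * cos y + Qe x * sin y) * (s * (- sin y) + Qe x * cos y)
                  + le l * (2 * sin y * cos y)) / s" for y
      have "norm (f x l y - f x l y') \<le> (2 * (s + K) * (s + K) + 2 * \<Lambda>) / s * norm (y - y')"
      proof (rule field_differentiable_bound[where f' = df and S = UNIV])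
        fix y
        show "(f x l has_field_derivative df y) (at y within UNIV)"
          unfolding f_def df_def using s
          by (auto intro!: derivative_eq_intros simp: field_simps power2_eq_square)
        have "\<bar>2 * (s * cos y + Qe x * sin y) * (s * (- sin y) + Qe x * cos y)\<bar> \<le> 2 * (s + K) * (s + K)"
          unfolding abs_mult using s K0 sumK[of "cos y" "sin y" x] sumK[of "- sin y" "cos y" x]
          by (intro mult_mono) auto
        moreover have "\<bar>le l * (2 * sin y * cos y)\<bar> \<le> \<Lambda> * (2 * 1 * 1)"
          unfolding abs_mult using le\<Lambda>[of l] \<Lambda>0 by (intro mult_mono) auto
        ultimately have "\<bar>df y * s\<bar> \<le> 2 * (s + K) * (s + K) + 2 * \<Lambda>"
          using s by (simp add: df_def)
        then show "norm (df y) \<le> (2 * (s + K) * (s + K) + 2 * \<Lambda>) / s"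
          using s by (simp add: abs_mult pos_le_divide_eq)
      qed auto
      then show ?thesis by simp
    qed
    show "\<bar>f x l y\<bar> \<le> ((s + K)\<^sup>2 + \<Lambda>) / s" for x l y
    proof -
      have "\<bar>(s * cos y + Qe x * sin y)\<^sup>2\<bar> \<le> (s + K)\<^sup>2"
        using sumK[of "cos y" "sin y" x] by (simp add: abs_le_square_iff[symmetric])
      moreover have "\<bar>le l * (sin y)\<^sup>2\<bar> \<le> \<Lambda> * 1"
        unfolding abs_mult using le\<Lambda>[of l] \<Lambda>0 by (intro mult_mono) (auto simp: abs_square_le_1)
      ultimately have "\<bar>(s * cos y + Qe x * sin y)\<^sup>2 + le l * (sin y)\<^sup>2\<bar> \<le> (s + K)\<^sup>2 + \<Lambda>"
        by linarith
      then have "\<bar>f x l y * s\<bar> \<le> (s + K)\<^sup>2 + \<Lambda>" using s by (simp add: f_def)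
      then show ?thesis using s by (simp add: abs_mult pos_le_divide_eq)
    qed
    show "(2 * (s + K) * (s + K) + 2 * \<Lambda>) / s > 0"
      using s K0 \<Lambda>0 by (intro divide_pos_pos add_pos_nonneg) auto
  qed auto
  define T where "T = \<gamma> + real n * pi"
  have c\<theta>: "continuous_on {0..pi} (\<lambda>x. \<theta> x l)" for l using \<theta>(3) by (rule DERIV_continuous_on)
  have low: "\<theta> pi lo \<le> T"
  proof -
    have "\<eta> pi - \<theta> pi lo > 0"
    proof (rule stays_positive[of 0 pi "\<lambda>x. \<eta> x - \<theta> x lo"])
      show "continuous_on {0..pi} (\<lambda>x. \<eta> x - \<theta> x lo)"
        unfolding \<eta>_def by (intro continuous_intros c\<theta>)
      show "\<eta> 0 - \<theta> 0 lo \<ge> 0" using \<beta> by (simp add: \<eta>_def p_def \<theta>(2))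
      fix x assume x: "x \<in> {0..pi}" and eq: "\<eta> x - \<theta> x lo = 0"
      have "(s * cos (\<eta> x) + Qe x * sin (\<eta> x))\<^sup>2 \<le> (s + K)\<^sup>2"
        using sumK[of "cos (\<eta> x)" "sin (\<eta> x)" x] by (simp add: abs_le_square_iff[symmetric])
      moreover have "lo * (sin (\<eta> x))\<^sup>2 \<le> lo * s0\<^sup>2"
        using s0(2)[OF x] s0(1) lohi(1) by (intro mult_left_mono_neg power_mono) auto
      moreover have "lo * s0\<^sup>2 = - ((s + K)\<^sup>2 + s * \<bar>m\<bar> + 1)" using s0(1) by (simp add: lo_def)
      ultimately have "f x lo (\<eta> x) * s \<le> - (s * \<bar>m\<bar>) - 1"
        using s le[of lo] lohi by (simp add: f_def)
      also have "\<dots> < m * s"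
      proof -
        have "- \<bar>m\<bar> \<le> m" by linarith
        then have "s * (- \<bar>m\<bar>) \<le> s * m" using s by (intro mult_left_mono) auto
        then show ?thesis by (simp add: mult.commute)
      qed
      finally have "f x lo (\<eta> x) < m" using s by simp
      moreover have "((\<lambda>x. \<eta> x - \<theta> x lo) has_real_derivative m - f x lo (\<theta> x lo)) (at x within {0..pi})"
        unfolding \<eta>_def by (rule derivative_eq_intros \<theta>(3)[OF x] refl)+ simp
      ultimately show "\<exists>d>0. ((\<lambda>x. \<eta> x - \<theta> x lo) has_real_derivative d) (at x within {0..pi})"
        using eq by (intro exI[of _ "m - f x lo (\<theta> x lo)"]) auto
    qed auto
    moreover have "\<eta> pi = \<gamma> / 2" by (simp add: \<eta>_def m_def)
    moreover have "0 \<le> real n * pi" by simp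
    ultimately show ?thesis using \<gamma>(1) unfolding T_def by linarith
  qed
  have high: "T \<le> \<theta> pi hi"
  proof -
    have fhi: "f x hi y \<ge> real n + 1" for x y
    proof -
      define a b where "a = s * cos y" and "b = Qe x * sin y"
      have "b\<^sup>2 \<le> K\<^sup>2 * (sin y)\<^sup>2"
        using QeK[of x] K0 by (simp add: b_def power_mult_distrib mult_right_mono abs_le_square_iff[symmetric])
      moreover have "0 \<le> (a + 2 * b)\<^sup>2" by simp
      then have "a\<^sup>2 / 2 - b\<^sup>2 \<le> (a + b)\<^sup>2" by (simp add: power2_eq_square algebra_simps)
      moreover have "hi * (sin y)\<^sup>2 = s\<^sup>2 / 2 * (sin y)\<^sup>2 + K\<^sup>2 * (sin y)\<^sup>2"
        by (simp add: hi_def algebra_simps)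
      moreover have "a\<^sup>2 / 2 + s\<^sup>2 / 2 * (sin y)\<^sup>2 = s\<^sup>2 / 2"
      proof -
        have "a\<^sup>2 / 2 + s\<^sup>2 / 2 * (sin y)\<^sup>2 = s\<^sup>2 / 2 * ((sin y)\<^sup>2 + (cos y)\<^sup>2)"
          unfolding a_def power_mult_distrib distrib_left by simp
        then show ?thesis by simp
      qed
      ultimately have "s\<^sup>2 / 2 \<le> (a + b)\<^sup>2 + hi * (sin y)\<^sup>2" by linarith
      then have "s\<^sup>2 / 2 / s \<le> f x hi y"
        using s le[of hi] lohi unfolding f_def a_def b_def by (intro divide_right_mono) auto
      moreover have "s\<^sup>2 / 2 / s = real n + 1" using s by (simp add: power2_eq_square) (simp add: s_def)
      ultimately show ?thesis by simp
    qed
    have "\<theta> 0 hi - (real n + 1) * 0 \<le> \<theta> pi hi - (real n + 1) * pi"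
    proof (rule DERIV_nonneg_imp_increasing_open[where f = "\<lambda>x. \<theta> x hi - (real n + 1) * x"])
      fix x assume x: "0 < x" "x < pi"
      have "at x within {0..pi} = at x" using x by (intro at_within_interior) auto
      then have "DERIV (\<lambda>x. \<theta> x hi) x :> f x hi (\<theta> x hi)" using \<theta>(3)[of x hi] x by simp
      then have "DERIV (\<lambda>x. \<theta> x hi - (real n + 1) * x) x :> f x hi (\<theta> x hi) - (real n + 1)"
        by (auto intro!: derivative_eq_intros)
      then show "\<exists>d. DERIV (\<lambda>x. \<theta> x hi - (real n + 1) * x) x :> d \<and> d \<ge> 0"
        using fhi by (intro exI[of _ "f x hi (\<theta> x hi) - (real n + 1)"]) auto
    next
      show "continuous_on {0..pi} (\<lambda>x. \<theta> x hi - (real n + 1) * x)"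
        by (intro continuous_intros c\<theta>)
    qed auto
    then have "\<theta> pi hi \<ge> pi + real n * pi" using \<beta>(1) by (simp add: \<theta>(2) distrib_right)
    then show ?thesis using \<gamma>(2) unfolding T_def by linarith
  qed
  have "continuous_on {lo..hi} (\<lambda>l. \<theta> pi l)"
    using continuous_on_compose2[OF \<theta>(1), of "{lo..hi}" "\<lambda>l. (pi, l)"]
    by (simp add: continuous_on_Pair)
  then obtain l where l: "l \<in> {lo..hi}" "\<theta> pi l = T"
    using IVT'[of "\<lambda>l. \<theta> pi l" lo T hi] low high lohi by auto
  define \<phi> where "\<phi> x = \<theta> x l" for x
  have d\<phi>: "(\<phi> has_real_derivative ((s * cos (\<phi> x) + Q x * sin (\<phi> x))\<^sup>2 + l * (sin (\<phi> x))\<^sup>2) / s)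
           (at x within {0..pi})" if "x \<in> {0..pi}" for x
    using \<theta>(3)[OF that, of l] Qe[OF that] le[OF l(1)] by (simp add: f_def \<phi>_def[abs_def])
  obtain r where r: "\<And>x. r x > 0"
    "quasi_sol Q (\<lambda>_. l) (\<lambda>x. r x * sin (\<phi> x)) (\<lambda>x. s * r x * cos (\<phi> x))"
    using phase_imp_quasi_sol[OF Q s d\<phi>] by blast
  let ?u = "\<lambda>x. r x * sin (\<phi> x)" and ?z = "\<lambda>x. s * r x * cos (\<phi> x)"
  have roots: "roots_0pi ?u = {x \<in> {0<..<pi}. sin (\<phi> x) = 0}"
    using r(1) by (auto simp: roots_0pi_def) (metis less_irrefl)
  have "\<exists>d>0. (\<phi> has_real_derivative d) (at x within {0..pi})" if "x \<in> {0..pi}" "sin (\<phi> x) = 0" for x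
  proof -
    have "(cos (\<phi> x))\<^sup>2 = 1" using that(2) sin_cos_squared_add[of "\<phi> x"] by simp
    then have "(\<phi> has_real_derivative s) (at x within {0..pi})"
      using d\<phi>[OF that(1)] that(2) s by (simp add: power_mult_distrib power2_eq_square[of s])
    then show ?thesis using s by blast
  qed
  then have card: "finite (roots_0pi ?u)" "card (roots_0pi ?u) = n"
    unfolding roots
    using phase_zero_count[of \<phi> \<gamma> n] DERIV_continuous_on[OF d\<phi>] \<beta> \<gamma> \<theta>(2) l(2)
    by (auto simp: \<phi>_def T_def)
  have "\<not> {0<..<pi} \<subseteq> roots_0pi ?u"
    using finite_subset[OF _ card(1)] infinite_Ioo[OF pi_gt_zero] by blast
  then have nz: "nonzero_0pi ?u" by (auto simp: nonzero_0pi_def roots_0pi_def)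
  have "quasi_bc \<alpha> Q ?u ?z"
    unfolding quasi_bc_def separated_bc_def
  proof
    have "?u 0 * cos \<alpha> + (?z 0 + Q 0 * ?u 0) * sin \<alpha>
        = r 0 * ((cos \<alpha> + Q 0 * sin \<alpha>) * sin \<beta> + (s * sin \<alpha>) * cos \<beta>)"
      by (simp add: \<phi>_def \<theta>(2) algebra_simps)
    then show "?u 0 * cos \<alpha> + (?z 0 + Q 0 * ?u 0) * sin \<alpha> = 0" using \<beta>(3) by simp
    have "sin (\<phi> pi) = (-1) ^ n * sin \<gamma>" "cos (\<phi> pi) = (-1) ^ n * cos \<gamma>"
      using l(2) by (simp_all add: \<phi>_def T_def sin_add cos_add sin_npi cos_npi)
    then have "?u pi * cos \<alpha> + (?z pi + Q pi * ?u pi) * sin \<alpha>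
        = r pi * (-1) ^ n * ((cos \<alpha> + Q pi * sin \<alpha>) * sin \<gamma> + (s * sin \<alpha>) * cos \<gamma>)"
      by (simp add: algebra_simps)
    then show "?u pi * cos \<alpha> + (?z pi + Q pi * ?u pi) * sin \<alpha> = 0" using \<gamma>(3) by simp
  qed
  then show ?thesis using r(2) nz card by blast
qed

section \<open>The eigenvalues ordered by the number of roots\<close>

lemma SL_comparison:
  fixes h1 h2 :: "real \<Rightarrow> real"
  assumes q: "q \<in> L2_0pi"
    and h: "continuous_on {0..pi} h1" "continuous_on {0..pi} h2"
    and op: "SL_operator \<alpha> q u1 (\<lambda>x. h1 x * u1 x)" "SL_operator \<alpha> q u2 (\<lambda>x. h2 x * u2 x)"
    and nz: "nonzero_0pi u1" "nonzero_0pi u2"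
    and less: "\<And>x. x \<in> {0<..<pi} \<Longrightarrow> u1 x \<noteq> 0 \<Longrightarrow> u2 x \<noteq> 0 \<Longrightarrow> h1 x < h2 x"
  shows "card (roots_0pi u1) < card (roots_0pi u2)"
proof -
  define Q where "Q x = integral {0..x} q" for x
  have cQ: "continuous_on {0..pi} Q"
    unfolding Q_def by (rule L2_0pi_primitive_continuous[OF q])
  obtain z1 where z1: "quasi_sol Q h1 u1 z1" "quasi_bc \<alpha> Q u1 z1"
    using SL_operator_imp_quasi_sol[OF q h(1) op(1)] unfolding Q_def by blast
  obtain z2 where z2: "quasi_sol Q h2 u2 z2" "quasi_bc \<alpha> Q u2 z2"
    using SL_operator_imp_quasi_sol[OF q h(2) op(2)] unfolding Q_def by blast
  show ?thesis
    by (rule sturm_comparison_card[OF z1(1) z2(1) z1(2) z2(2) less])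
      (use quasi_sol_finite_roots[OF z1(1) cQ h(1) nz(1)]
        quasi_sol_finite_roots[OF z2(1) cQ h(2) nz(2)] in auto)
qed

text \<open>
  Eigenfunctions for the same coefficient have a constant Wronskian, which is zero by the boundary
  conditions; a root of one is a simple root and hence a root of the other.
\<close>

lemma SL_same_roots:
  assumes q: "q \<in> L2_0pi" and h: "continuous_on {0..pi} h"
    and op: "SL_operator \<alpha> q u1 (\<lambda>x. h x * u1 x)" "SL_operator \<alpha> q u2 (\<lambda>x. h x * u2 x)"
    and nz: "nonzero_0pi u1"
  shows "roots_0pi u1 \<subseteq> roots_0pi u2"
proof
  fix c assume c: "c \<in> roots_0pi u1"
  then have c0: "c \<in> {0..pi}" and u1c: "u1 c = 0" by (auto simp: roots_0pi_def)
  define Q where "Q x = integral {0..x} q" for x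
  have cQ: "continuous_on {0..pi} Q"
    unfolding Q_def by (rule L2_0pi_primitive_continuous[OF q])
  obtain z1 where z1: "quasi_sol Q h u1 z1" "quasi_bc \<alpha> Q u1 z1"
    using SL_operator_imp_quasi_sol[OF q h op(1)] unfolding Q_def by blast
  obtain z2 where z2: "quasi_sol Q h u2 z2" "quasi_bc \<alpha> Q u2 z2"
    using SL_operator_imp_quasi_sol[OF q h op(2)] unfolding Q_def by blast
  define W where "W x = u1 x * z2 x - z1 x * u2 x" for x
  have "(W has_real_derivative 0) (at x within {0..pi})" if "x \<in> {0..pi}" for x
    using wronskian_deriv[OF z1(1) z2(1) that] by (simp add: W_def[abs_def])
  then obtain k where "\<And>x. x \<in> {0..pi} \<Longrightarrow> W x = k"
    using has_field_derivative_zero_constant[of "{0..pi}" W] by auto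
  then have "W c = W 0" using c0 by auto
  then have "z1 c * u2 c = 0"
    using wronskian_ends(1)[OF z1(2) z2(2)] u1c by (simp add: W_def)
  moreover have "z1 c \<noteq> 0"
    using quasi_sol_double_zero[OF z1(1) cQ h c0 u1c] nz by (auto simp: nonzero_0pi_def)
  ultimately show "c \<in> roots_0pi u2" using c by (simp add: roots_0pi_def)
qed

lemma SL_finite_roots:
  assumes q: "q \<in> L2_0pi" and h: "continuous_on {0..pi} h"
    and op: "SL_operator \<alpha> q u (\<lambda>x. h x * u x)" and nz: "nonzero_0pi u"
  shows "finite (roots_0pi u)"
proof -
  define Q where "Q x = integral {0..x} q" for x
  have cQ: "continuous_on {0..pi} Q"
    unfolding Q_def by (rule L2_0pi_primitive_continuous[OF q])
  obtain z where z: "quasi_sol Q h u z"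
    using SL_operator_imp_quasi_sol[OF q h op] unfolding Q_def by blast
  show ?thesis by (rule quasi_sol_finite_roots[OF z cQ h nz])
qed

text \<open>
  An eigenfunction \<open>u\<close> of \<open>L[q]\<close> for the eigenvalue \<open>l\<close>.
\<close>

definition eigenfunction ::
  "real \<Rightarrow> (real \<Rightarrow> real) \<Rightarrow> real \<Rightarrow> (real \<Rightarrow> real) \<Rightarrow> bool" where
  "eigenfunction \<alpha> q l u \<longleftrightarrow> nonzero_0pi u \<and> SL_operator \<alpha> q u (\<lambda>x. l * u x)"

lemma ex_eigenfunction:
  assumes q: "q \<in> L2_0pi"
  shows "\<exists>l u. eigenfunction \<alpha> q l u \<and> card (roots_0pi u) = n"
proof -
  show ?thesis
    using L2_0pi_primitive_continuous[OF q] eigenfunction_with_roots[of "\<lambda>x. integral {0..x} q" \<alpha> n]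
      quasi_sol_imp_SL_operator[OF q continuous_on_const]
    unfolding eigenfunction_def by metis
qed

lemma eigenfunction_roots_less:
  assumes q: "q \<in> L2_0pi" and "eigenfunction \<alpha> q l u" "eigenfunction \<alpha> q m w" "l < m"
  shows "card (roots_0pi u) < card (roots_0pi w)"
  by (rule SL_comparison[where ?h1.0 = "\<lambda>_. l" and ?h2.0 = "\<lambda>_. m" and \<alpha> = \<alpha>, OF q])
    (use assms in \<open>simp_all add: eigenfunction_def\<close>)

lemma eigenfunction_roots_eq:
  assumes q: "q \<in> L2_0pi" and "eigenfunction \<alpha> q l u" "eigenfunction \<alpha> q l w"
  shows "roots_0pi u = roots_0pi w"
proof -
  have u: "SL_operator \<alpha> q u (\<lambda>x. l * u x)" "nonzero_0pi u"
    and w: "SL_operator \<alpha> q w (\<lambda>x. l * w x)" "nonzero_0pi w"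
    using assms by (simp_all add: eigenfunction_def)
  show ?thesis
    using SL_same_roots[OF q continuous_on_const u(1) w(1) u(2)]
      SL_same_roots[OF q continuous_on_const w(1) u(1) w(2)] by (rule equalityI)
qed

text \<open>
  The number of roots is a strictly increasing bijection from the eigenvalues to the natural numbers.
  So the eigenvalue whose eigenfunctions have \<open>k - 1\<close> roots has exactly \<open>k - 1\<close> eigenvalues below it,
  and it is the only eigenvalue with that property.
\<close>

lemma SL_lambda_eigenfunction:
  assumes q: "q \<in> L2_0pi" and k: "k \<ge> 1"
  shows "\<exists>u. eigenfunction \<alpha> q (SL_lambda \<alpha> k q) u \<and> card (roots_0pi u) = k - 1"
proof -
  obtain \<mu> \<phi> where \<mu>: "\<And>n. eigenfunction \<alpha> q (\<mu> n) (\<phi> n)" "\<And>n. card (roots_0pi (\<phi> n)) = n"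
    using ex_eigenfunction[OF q, of \<alpha>] by metis
  have ev: "SL_eigenvalue \<alpha> q m \<longleftrightarrow> (\<exists>u. eigenfunction \<alpha> q m u)" for m
    by (simp add: SL_eigenvalue_def eigenfunction_def)
  have less: "i < j" if "\<mu> i < \<mu> j" for i j
    using eigenfunction_roots_less[OF q \<mu>(1) \<mu>(1) that] by (simp add: \<mu>(2))
  have eq: "i = j" if "\<mu> i = \<mu> j" for i j
  proof -
    have "eigenfunction \<alpha> q (\<mu> i) (\<phi> j)" unfolding that by (rule \<mu>(1))
    then have "roots_0pi (\<phi> i) = roots_0pi (\<phi> j)"
      by (rule eigenfunction_roots_eq[OF q \<mu>(1)[of i]])
    then have "card (roots_0pi (\<phi> i)) = card (roots_0pi (\<phi> j))" by (rule arg_cong)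
    then show ?thesis unfolding \<mu>(2) .
  qed
  have mono: "\<mu> i < \<mu> j \<longleftrightarrow> i < j" for i j
    using less[of i j] less[of j i] eq[of i j] by (cases rule: linorder_cases[of "\<mu> i" "\<mu> j"]) auto
  have all: "SL_eigenvalue \<alpha> q m \<longleftrightarrow> m \<in> range \<mu>" for m
  proof
    assume "SL_eigenvalue \<alpha> q m"
    then obtain u where u: "eigenfunction \<alpha> q m u" using ev by blast
    define n where "n = card (roots_0pi u)"
    have "\<not> m < \<mu> n"
      using eigenfunction_roots_less[OF q u \<mu>(1)[of n]] by (auto simp: \<mu>(2) n_def)
    moreover have "\<not> \<mu> n < m"
      using eigenfunction_roots_less[OF q \<mu>(1)[of n] u] by (auto simp: \<mu>(2) n_def)
    ultimately have "m = \<mu> n" by simp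
    then show "m \<in> range \<mu>" by blast
  qed (use \<mu>(1) ev in blast)
  have below: "{m. SL_eigenvalue \<alpha> q m \<and> m < \<mu> j} = \<mu> ` {..<j}" for j
    unfolding all using mono by auto
  have "inj \<mu>" using eq by (rule injI)
  then have card: "card {m. SL_eigenvalue \<alpha> q m \<and> m < \<mu> j} = j" for j
    unfolding below by (simp add: card_image inj_on_subset)
  have "SL_lambda \<alpha> k q = \<mu> (k - 1)"
    unfolding SL_lambda_def
  proof (rule the_equality)
    show "SL_eigenvalue \<alpha> q (\<mu> (k - 1)) \<and>
      finite {m. SL_eigenvalue \<alpha> q m \<and> m < \<mu> (k - 1)} \<and>
      Suc (card {m. SL_eigenvalue \<alpha> q m \<and> m < \<mu> (k - 1)}) = k"
      using k all[of "\<mu> (k - 1)"] unfolding card unfolding below by simp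
    fix l assume l: "SL_eigenvalue \<alpha> q l \<and> finite {m. SL_eigenvalue \<alpha> q m \<and> m < l} \<and>
      Suc (card {m. SL_eigenvalue \<alpha> q m \<and> m < l}) = k"
    then obtain j where "l = \<mu> j" using all by blast
    then show "l = \<mu> (k - 1)" using l card[of j] by auto
  qed
  then show ?thesis using \<mu> by metis
qed

section \<open>Solutions of the nonlinear problem\<close>

theorem lemma1:
  fixes \<alpha> :: real and q0 :: "real \<Rightarrow> real" and k :: nat
  assumes "q0 \<in> L2_0pi" and "k \<ge> 1"
  shows "(\<forall>l \<ge> SL_lambda \<alpha> k q0.
            \<not> (\<exists>u. NP_weak_solution \<alpha> q0 l 1 u \<and> nonzero_0pi u \<and>
                   finite (roots_0pi u) \<and> card (roots_0pi u) \<le> k - 1))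
       \<and> (\<forall>l \<le> SL_lambda \<alpha> k q0.
            \<not> (\<exists>u. NP_weak_solution \<alpha> q0 l (-1) u \<and> nonzero_0pi u \<and>
                   (infinite (roots_0pi u) \<or> card (roots_0pi u) \<ge> k - 1)))"
proof -
  note q = assms(1)
  define \<Lambda> where "\<Lambda> = SL_lambda \<alpha> k q0"
  obtain \<phi> where \<phi>: "nonzero_0pi \<phi>" "SL_operator \<alpha> q0 \<phi> (\<lambda>x. \<Lambda> * \<phi> x)" "card (roots_0pi \<phi>) = k - 1"
    using SL_lambda_eigenfunction[OF assms] unfolding eigenfunction_def \<Lambda>_def by blast
  have lin: "SL_operator \<alpha> q0 u (\<lambda>x. (l + d * (u x)\<^sup>2) * u x)" "continuous_on {0..pi} (\<lambda>x. l + d * (u x)\<^sup>2)"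
    if u: "NP_weak_solution \<alpha> q0 l d u" for u l d
  proof -
    show "SL_operator \<alpha> q0 u (\<lambda>x. (l + d * (u x)\<^sup>2) * u x)"
      using u by (simp add: NP_weak_solution_def algebra_simps power2_eq_square power3_eq_cube)
    obtain v w where "W22_0pi u v w" using u by (auto simp: NP_weak_solution_def SL_operator_def)
    then have "continuous_on {0..pi} u"
      unfolding W22_0pi_def by (intro DERIV_continuous_on[of _ _ v]) blast
    then show "continuous_on {0..pi} (\<lambda>x. l + d * (u x)\<^sup>2)" by (intro continuous_intros)
  qed
  \<comment> \<open>A solution \<open>u\<close> is compared with \<open>\<phi>\<close> as a solution of the linear equation with the coefficient \<open>l + \<delta> u\<^sup>2\<close> in place of \<open>\<Lambda>\<close>.\<close>
  have "k - 1 < card (roots_0pi u)"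
    if l: "\<Lambda> \<le> l" and u: "NP_weak_solution \<alpha> q0 l 1 u" "nonzero_0pi u" for l u
  proof -
    have "\<Lambda> < l + 1 * (u x)\<^sup>2" if "u x \<noteq> 0" for x
      using l that zero_less_power2[of "u x"] by linarith
    then show ?thesis
      using SL_comparison[OF q continuous_on_const lin(2)[OF u(1)] \<phi>(2) lin(1)[OF u(1)] \<phi>(1) u(2)] \<phi>(3)
      by simp
  qed
  moreover have "finite (roots_0pi u) \<and> card (roots_0pi u) < k - 1"
    if l: "l \<le> \<Lambda>" and u: "NP_weak_solution \<alpha> q0 l (-1) u" "nonzero_0pi u" for l u
  proof
    show "finite (roots_0pi u)" by (rule SL_finite_roots[OF q lin(2,1)[OF u(1)] u(2)])
    have "l + -1 * (u x)\<^sup>2 < \<Lambda>" if "u x \<noteq> 0" for x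
      using l that zero_less_power2[of "u x"] by linarith
    then show "card (roots_0pi u) < k - 1"
      using SL_comparison[OF q lin(2)[OF u(1)] continuous_on_const lin(1)[OF u(1)] \<phi>(2) u(2) \<phi>(1)] \<phi>(3)
      by simp
  qed
  ultimately show ?thesis unfolding \<Lambda>_def by (meson leD)
qed

end
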